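(* Let $n\ge1$ and let $U\subset\mathbb{C}^n$ be a domain with a complete Kähler metric $\Phi_U$ (for instance a domain of holomorphy) and with $H^1(U,\mathbb{Z})=0$. Let $D_j$ ($j\in\mathbb{N}$) and $D_0$ be non-negative principal divisors on $U$ with $D_j\to D_0$ (in the weak* sense of currents of integration), and let $f_j,f_0$ be holomorphic functions on $U$ with ${\sf Div}(f_j)=D_j$, ${\sf Div}(f_0)=D_0$ and $f_j\to f_0$ uniformly on compact subsets of $U$. Let $\phi_j=f_j^*(g)+\Phi_U$ and $\phi_0=f_0^*(g)+\Phi_U$ be the corresponding complete Kähler metrics on $U\setminus|D_j|$ and $U\setminus|D_0|$, where $g$ is the Grauert metric on $\mathbb{C}^*$. Fix $p\in U\setminus|D_0|$. Then: (i) For every non-singular holomorphic vector field $X$ near $p$, there exists a neighbourhood $U_p$ of $p$ in $U\setminus|D_0|$ such that $\mathcal{K}^X_{\phi_j}(q)\to\mathcal{K}^X_{\phi_0}(q)$ as $j\to\infty$ for all $q\in U_p$. (ii) $K_{\phi_0}(p,V)\le\liminf_{j\to\infty}K_{\phi_j}(p,V)$ for all nonzero $V\in\mathbb{C}^n$.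
   Context: Divisors: for a holomorphic function $f\not\equiv0$ on $U$, ${\sf Div}(f)=\sum_i({\rm ord}_{V_i}f)V_i$, the sum being over the irreducible components $V_i$ of the zero set of $f$, with ${\rm ord}_{V_i}f$ the vanishing order along $V_i$; such divisors are the non-negative principal divisors, and the support $|{\sf Div}(f)|$ is the zero set of $f$. A non-negative divisor $D=\sum_i m_iV_i$ is identified with the current of integration $\alpha\mapsto\int_D\alpha=\sum_i m_i\int_{V_i}\alpha$ on compactly supported smooth $(n-1,n-1)$-forms; $D_j\to D_0$ in the weak* sense means $\int_{D_j}\alpha\to\int_{D_0}\alpha$ for all such $\alpha$. (On the set of non-negative divisors this topology coincides with the strong topology of currents and with Stoll's topology.) Grauert metric: $g=\big(1+|w|^2u^2(|w|^2)\big)|dw|^2$ on $\mathbb{C}^*$, where $u(t)=\frac{t-1}{t\log t}$ on $(0,\infty)$, with $u(1)=1$ (real analytic). Gaussian curvature of a conformal metric $h(T)|dT|^2$ ($h>0$ smooth): $-2h^{-3}\big(h\,\partial\bar\partial h-\partial h\,\bar\partial h\big)$, with $\partial=\partial/\partial T$, $\bar\partial=\partial/\partial\bar T$. A non-singular holomorphic vector field is a nowhere vanishing one. For a Kähler metric $\phi$ and a non-singular holomorphic vector field $X$ near $p$, $\mathcal{K}^X_\phi(q)$ is the Gaussian curvature at $q$ of the restriction of $\phi$ to the leaf through $q$ of the foliation induced by $X$; i.e. the Gaussian curvature at $T=0$ of $Z^*\phi$, where $Z:B(0,\epsilon)\subset\mathbb{C}\to U$ is holomorphic with $Z(0)=q$,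 $Z'(T)=X(Z(T))$. $K_\phi(p,V)$ is the holomorphic sectional curvature of $\phi$ at $p$ in the direction $V\ne0$ (normalized so that in complex dimension one it is the Gaussian curvature; equivalently the maximum of the Gaussian curvatures at $p$ of the restrictions of $\phi$ to germs of embedded Riemann surfaces through $p$ tangent to $V$). Since $D_j\to D_0$, a sufficiently small neighbourhood of $p$ lies in $U\setminus|D_j|$ for all large $j$, and the quantities for $\phi_j$ are considered for such $j$. *)

theory Defs
  imports "HOL-Analysis.Analysis" "HOL-Homology.Homology" "HOL-Combinatorics.Permutations"
begin

section \<open>Holomorphic functions on open subsets of $C^n$\<close>

text \<open>
  Points of $C^n$ are elements of \<^typ>\<open>complex^'n\<close>, with $n = $ \<^term>\<open>CARD('n)\<close>; complex scalar
  multiplication on vectors is \<^term>\<open>(*s)\<close>. Holomorphy means complex differentiability, and it is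
  only meaningful on open sets.
\<close>

definition holo_on :: "(complex^'n) set \<Rightarrow> (complex^'n \<Rightarrow> complex) \<Rightarrow> bool" where
  "holo_on U f \<longleftrightarrow>
     (\<forall>z\<in>U. \<exists>L. (f has_derivative L) (at z) \<and> (\<forall>c v. L (c *s v) = c * L v))"

definition vec_holo_on :: "(complex^'n) set \<Rightarrow> (complex^'n \<Rightarrow> complex^'m) \<Rightarrow> bool" where
  "vec_holo_on U F \<longleftrightarrow> (\<forall>i. holo_on U (\<lambda>z. F z $ i))"

definition domain_Cn :: "(complex^'n) set \<Rightarrow> bool" where
  "domain_Cn U \<longleftrightarrow> open U \<and> connected U \<and> U \<noteq> {}"

text \<open>Wirtinger derivatives $\partial/\partial z_k$ and $\partial/\partial\bar z_k$.\<close>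

definition wirt :: "'n \<Rightarrow> (complex^'n \<Rightarrow> complex) \<Rightarrow> complex^'n \<Rightarrow> complex" where
  "wirt k f z =
     (frechet_derivative f (at z) (axis k 1) - \<i> * frechet_derivative f (at z) (axis k \<i>)) / 2"

definition wirt_bar :: "'n \<Rightarrow> (complex^'n \<Rightarrow> complex) \<Rightarrow> complex^'n \<Rightarrow> complex" where
  "wirt_bar k f z =
     (frechet_derivative f (at z) (axis k 1) + \<i> * frechet_derivative f (at z) (axis k \<i>)) / 2"

text \<open>
  Real $C^\infty$ functions on an open set: all iterated directional derivatives exist and are
  themselves (Frechet) differentiable.
\<close>

primrec Ck_on :: "nat \<Rightarrow> 'a::real_normed_vector set \<Rightarrow> ('a \<Rightarrow> 'b::real_normed_vector) \<Rightarrow> bool" where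
  "Ck_on 0 S f \<longleftrightarrow> continuous_on S f"
| "Ck_on (Suc k) S f \<longleftrightarrow>
     (\<forall>x\<in>S. f differentiable (at x)) \<and>
     (\<forall>v. Ck_on k S (\<lambda>x. frechet_derivative f (at x) v))"

definition smooth_fun_on :: "'a::real_normed_vector set \<Rightarrow> ('a \<Rightarrow> 'b::real_normed_vector) \<Rightarrow> bool" where
  "smooth_fun_on S f \<longleftrightarrow> (\<forall>k. Ck_on k S f)"


section \<open>Vanishing of singular cohomology with integer coefficients\<close>

definition singular_cochain :: "nat \<Rightarrow> 'a topology \<Rightarrow> ('a chain \<Rightarrow> int) \<Rightarrow> bool" where
  "singular_cochain p X c \<longleftrightarrow> c \<in> hom (chain_group p X) integer_group"

text \<open>$H^{p+1}(X,Z) = 0$: every cocycle of degree $p+1$ is a coboundary.\<close>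

definition singular_cohomology_Suc_zero :: "nat \<Rightarrow> 'a topology \<Rightarrow> bool" where
  "singular_cohomology_Suc_zero p X \<longleftrightarrow>
     (\<forall>c. singular_cochain (Suc p) X c \<and>
          (\<forall>x. singular_chain (Suc (Suc p)) X x \<longrightarrow> c (chain_boundary (Suc (Suc p)) x) = 0)
        \<longrightarrow> (\<exists>b. singular_cochain p X b \<and>
                 (\<forall>x. singular_chain (Suc p) X x \<longrightarrow> c x = b (chain_boundary (Suc p) x))))"

definition H1_int_zero :: "(complex^'n) set \<Rightarrow> bool" where
  "H1_int_zero U \<longleftrightarrow> singular_cohomology_Suc_zero 0 (top_of_set U)"


section \<open>Analytic sets and divisors\<close>

definition analytic_subset :: "(complex^'n) set \<Rightarrow> (complex^'n) set \<Rightarrow> bool" where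
  "analytic_subset U A \<longleftrightarrow> A \<subseteq> U \<and>
     (\<forall>a\<in>U. \<exists>W \<F>. open W \<and> a \<in> W \<and> W \<subseteq> U \<and> finite \<F> \<and> (\<forall>h\<in>\<F>. holo_on W h) \<and>
        A \<inter> W = {z\<in>W. \<forall>h\<in>\<F>. h z = 0})"

definition irreducible_analytic :: "(complex^'n) set \<Rightarrow> (complex^'n) set \<Rightarrow> bool" where
  "irreducible_analytic U A \<longleftrightarrow> analytic_subset U A \<and> A \<noteq> {} \<and>
     \<not> (\<exists>B C. analytic_subset U B \<and> analytic_subset U C \<and> B \<subset> A \<and> C \<subset> A \<and> A = B \<union> C)"

definition irreducible_component_of :: "(complex^'n) set \<Rightarrow> (complex^'n) set \<Rightarrow> (complex^'n) set \<Rightarrow> bool" where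
  "irreducible_component_of U A V \<longleftrightarrow> irreducible_analytic U V \<and> V \<subseteq> A \<and>
     (\<forall>V'. irreducible_analytic U V' \<and> V' \<subseteq> A \<and> V \<subseteq> V' \<longrightarrow> V' = V)"

text \<open>This is also the support $|\mathrm{Div}(f)|$ of the divisor of \<open>f\<close>.\<close>

definition zero_set :: "(complex^'n) set \<Rightarrow> (complex^'n \<Rightarrow> complex) \<Rightarrow> (complex^'n) set" where
  "zero_set U f = {z\<in>U. f z = 0}"

text \<open>Divisibility $e \mid f$ in the ring of germs of holomorphic functions at $p$.\<close>

definition germ_dvd :: "complex^'n \<Rightarrow> (complex^'n \<Rightarrow> complex) \<Rightarrow> (complex^'n \<Rightarrow> complex) \<Rightarrow> bool" where
  "germ_dvd p e f \<longleftrightarrow> (\<exists>W k. open W \<and> p \<in> W \<and> holo_on W k \<and> (\<forall>z\<in>W. f z = e z * k z))"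

text \<open>
  A local defining function of the hypersurface \<open>V\<close> at \<open>p\<close>: its zero set is \<open>V\<close> near \<open>p\<close> and its
  germ generates the ideal of germs at \<open>p\<close> vanishing on \<open>V\<close>.
\<close>

definition local_defining_function ::
  "(complex^'n) set \<Rightarrow> complex^'n \<Rightarrow> (complex^'n) set \<Rightarrow> (complex^'n \<Rightarrow> complex) \<Rightarrow> bool" where
  "local_defining_function V p W h \<longleftrightarrow>
     open W \<and> p \<in> W \<and> holo_on W h \<and> V \<inter> W = {z\<in>W. h z = 0} \<and>
     (\<forall>W' e. open W' \<and> p \<in> W' \<and> W' \<subseteq> W \<and> holo_on W' e \<and> (\<forall>z\<in>V \<inter> W'. e z = 0)
        \<longrightarrow> germ_dvd p h e)"

text \<open>
  The vanishing order along an irreducible hypersurface \<open>V\<close>: the largest \<open>m\<close> such that \<open>f\<close> is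
  divisible, at the points of \<open>V\<close>, by the \<open>m\<close>-th power of a local defining function of \<open>V\<close>.
\<close>

definition vanishing_order :: "(complex^'n) set \<Rightarrow> (complex^'n \<Rightarrow> complex) \<Rightarrow> nat" where
  "vanishing_order V f =
     (GREATEST m. \<forall>p\<in>V. \<forall>W h. local_defining_function V p W h \<longrightarrow> germ_dvd p (\<lambda>z. h z ^ m) f)"

text \<open>
  A non-negative divisor is given by its multiplicity function on irreducible hypersurfaces.
\<close>

type_synonym 'n divisor = "(complex^'n) set \<Rightarrow> nat"

definition Div :: "(complex^'n) set \<Rightarrow> (complex^'n \<Rightarrow> complex) \<Rightarrow> 'n divisor" where
  "Div U f = (\<lambda>V. if irreducible_component_of U (zero_set U f) V then vanishing_order V f else 0)"


section \<open>Test forms and currents of integration\<close>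

text \<open>
  A (pointwise) form of degree \<open>d\<close> is evaluated on lists of \<open>d\<close> tangent vectors. The wedge product
  of a list of one-forms follows the determinant convention.
\<close>

definition wedge :: "(complex^'n \<Rightarrow> complex) list \<Rightarrow> (complex^'n) list \<Rightarrow> complex" where
  "wedge Ls vs =
     (\<Sum>\<sigma> | \<sigma> permutes {..<length Ls}. of_int (sign \<sigma>) * (\<Prod>a<length Ls. (Ls ! a) (vs ! \<sigma> a)))"

text \<open>$dz_{i_1}\wedge\dots\wedge dz_{i_p}\wedge d\bar z_{j_1}\wedge\dots\wedge d\bar z_{j_q}$\<close>

definition dz_dzbar :: "'n list \<Rightarrow> 'n list \<Rightarrow> (complex^'n) list \<Rightarrow> complex" where
  "dz_dzbar I J = wedge (map (\<lambda>i v. v $ i) I @ map (\<lambda>j v. cnj (v $ j)) J)"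

text \<open>
  Smooth $(p,q)$-forms with compact support in \<open>U\<close>. Summing over all multi-indices, rather than
  the increasing ones, yields the same forms and needs no order on the index type.
\<close>

definition test_forms ::
  "(complex^'n) set \<Rightarrow> nat \<Rightarrow> nat \<Rightarrow> (complex^'n \<Rightarrow> (complex^'n) list \<Rightarrow> complex) set" where
  "test_forms U p q =
     {\<alpha>. \<exists>a K. compact K \<and> K \<subseteq> U \<and>
        (\<forall>I J. smooth_fun_on UNIV (a I J) \<and> (\<forall>z. z \<notin> K \<longrightarrow> a I J z = 0)) \<and>
        \<alpha> = (\<lambda>z vs. \<Sum>I | length I = p. \<Sum>J | length J = q. a I J z * dz_dzbar I J vs)}"

text \<open>
  Hypersurface charts: a biholomorphic map \<open>F\<close> from \<open>W\<close> onto an open set that straightens \<open>V\<close> to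
  the coordinate hyperplane $w_k = 0$. The regular part of \<open>V\<close> is what such charts cover.
\<close>

definition hypersurface_chart ::
  "(complex^'n) set \<Rightarrow> 'n \<Rightarrow> (complex^'n) set \<Rightarrow> (complex^'n \<Rightarrow> complex^'n) \<Rightarrow> bool" where
  "hypersurface_chart V k W F \<longleftrightarrow>
     open W \<and> inj_on F W \<and> vec_holo_on W F \<and> open (F ` W) \<and>
     vec_holo_on (F ` W) (inv_into W F) \<and> V \<inter> F ` W = F ` {w\<in>W. w $ k = 0}"

definition regular_part :: "(complex^'n) set \<Rightarrow> (complex^'n) set" where
  "regular_part V = {a\<in>V. \<exists>k W F. hypersurface_chart V k W F \<and> a \<in> F ` W}"

definition hyperplane_embed :: "'n \<Rightarrow> ('n \<Rightarrow> complex) \<Rightarrow> complex^'n" where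
  "hyperplane_embed k y = (\<chi> i. if i = k then 0 else y i)"

text \<open>
  The positively oriented real frame $(\partial_{x_i}F, \partial_{y_i}F)_{i\ne k}$, listed in some
  order of the indices \<open>i\<close>; transposing two indices is an even permutation of the frame.
\<close>

definition chart_frame :: "'n \<Rightarrow> (complex^'n \<Rightarrow> complex^'n) \<Rightarrow> complex^'n \<Rightarrow> (complex^'n) list" where
  "chart_frame k F w =
     concat (map (\<lambda>i. [frechet_derivative F (at w) (axis i 1), frechet_derivative F (at w) (axis i \<i>)])
       (SOME is. distinct is \<and> set is = UNIV - {k}))"

text \<open>
  Integral of a form of degree $2n-2$ over the part \<open>A\<close> of \<open>V\<close> lying in a chart. The parameter
  space $C^{n-1}$ is the space of functions on the indices different from \<open>k\<close>, with Lebesgue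
  measure; it is a single point of mass 1 if $n = 1$.
\<close>

definition chart_integral ::
  "'n \<Rightarrow> (complex^'n) set \<Rightarrow> (complex^'n \<Rightarrow> complex^'n) \<Rightarrow> (complex^'n) set \<Rightarrow>
   (complex^'n \<Rightarrow> (complex^'n) list \<Rightarrow> complex) \<Rightarrow> complex" where
  "chart_integral k W F A \<alpha> =
     (LINT y : {y \<in> space (Pi\<^sub>M (UNIV - {k}) (\<lambda>_. lborel)). hyperplane_embed k y \<in> W \<and> F (hyperplane_embed k y) \<in> A}
        | Pi\<^sub>M (UNIV - {k}) (\<lambda>_. lborel).
        \<alpha> (F (hyperplane_embed k y)) (chart_frame k F (hyperplane_embed k y)))"

text \<open>
  The integral over \<open>V\<close> is the integral over its regular part, computed by cutting the regular
  part into countably many disjoint Borel pieces, each contained in a chart. For test forms it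
  converges absolutely (the area of \<open>V\<close> is locally finite) and does not depend on the choices.
\<close>

definition hypersurface_integral ::
  "(complex^'n) set \<Rightarrow> (complex^'n \<Rightarrow> (complex^'n) list \<Rightarrow> complex) \<Rightarrow> complex" where
  "hypersurface_integral V \<alpha> =
     (THE s. \<exists>A k W F.
        (\<forall>m::nat. hypersurface_chart V (k m) (W m) (F m) \<and> A m \<in> sets borel \<and> A m \<subseteq> F m ` W m) \<and>
        disjoint_family A \<and> (\<Union>m. A m) = regular_part V \<and>
        (\<lambda>m. chart_integral (k m) (W m) (F m) (A m) \<alpha>) sums s)"

text \<open>Only finitely many terms of the following sum are nonzero, if \<open>\<alpha>\<close> is a test form.\<close>

definition divisor_integral ::
  "'n divisor \<Rightarrow> (complex^'n \<Rightarrow> (complex^'n) list \<Rightarrow> complex) \<Rightarrow> complex" where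
  "divisor_integral D \<alpha> =
     (\<Sum>\<^sub>\<infinity>V\<in>{V. D V \<noteq> 0}. of_nat (D V) * hypersurface_integral V \<alpha>)"

definition divisors_converge ::
  "(complex^'n) set \<Rightarrow> (nat \<Rightarrow> 'n divisor) \<Rightarrow> 'n divisor \<Rightarrow> bool" where
  "divisors_converge U D D0 \<longleftrightarrow>
     (\<forall>\<alpha>\<in>test_forms U (CARD('n) - 1) (CARD('n) - 1).
        (\<lambda>j. divisor_integral (D j) \<alpha>) \<longlonglongrightarrow> divisor_integral D0 \<alpha>)"


section \<open>Kaehler metrics\<close>

text \<open>
  A Hermitian metric is given by its coefficient matrices $g_{i\bar j}$; the associated Hermitian
  form is $\sum g_{i\bar j} v_i \bar w_j$. For $n=1$ the matrix \<open>h\<close> is the conformal metric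
  $h|dz|^2$.
\<close>

type_synonym 'n metric = "complex^'n \<Rightarrow> complex^'n^'n"

definition herm_form :: "complex^'n^'n \<Rightarrow> complex^'n \<Rightarrow> complex^'n \<Rightarrow> complex" where
  "herm_form G v w = (\<Sum>i\<in>UNIV. \<Sum>j\<in>UNIV. G $ i $ j * v $ i * cnj (w $ j))"

definition norm_sq :: "complex^'n^'n \<Rightarrow> complex^'n \<Rightarrow> real" where
  "norm_sq G v = Re (herm_form G v v)"

definition hermitian_metric :: "(complex^'n) set \<Rightarrow> 'n metric \<Rightarrow> bool" where
  "hermitian_metric U G \<longleftrightarrow> smooth_fun_on U G \<and>
     (\<forall>z\<in>U. (\<forall>i j. G z $ j $ i = cnj (G z $ i $ j)) \<and> (\<forall>v. v \<noteq> 0 \<longrightarrow> 0 < norm_sq (G z) v))"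

definition fundamental_form :: "'n metric \<Rightarrow> complex^'n \<Rightarrow> complex^'n \<Rightarrow> complex^'n \<Rightarrow> real" where
  "fundamental_form G z v w = - Im (herm_form (G z) v w)"

text \<open>The fundamental form is closed (its exterior derivative on constant vector fields vanishes).\<close>

definition kahler_metric :: "(complex^'n) set \<Rightarrow> 'n metric \<Rightarrow> bool" where
  "kahler_metric U G \<longleftrightarrow> hermitian_metric U G \<and>
     (\<forall>z\<in>U. \<forall>u v w.
        frechet_derivative (\<lambda>x. fundamental_form G x v w) (at z) u
      - frechet_derivative (\<lambda>x. fundamental_form G x u w) (at z) v
      + frechet_derivative (\<lambda>x. fundamental_form G x u v) (at z) w = 0)"

definition metric_length :: "'n metric \<Rightarrow> (real \<Rightarrow> complex^'n) \<Rightarrow> real" where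
  "metric_length G \<gamma> = integral {0..1} (\<lambda>t. sqrt (norm_sq (G (\<gamma> t)) (vector_derivative \<gamma> (at t))))"

definition metric_dist :: "(complex^'n) set \<Rightarrow> 'n metric \<Rightarrow> complex^'n \<Rightarrow> complex^'n \<Rightarrow> real" where
  "metric_dist U G x y =
     Inf {metric_length G \<gamma> |\<gamma>.
            valid_path \<gamma> \<and> path_image \<gamma> \<subseteq> U \<and> pathstart \<gamma> = x \<and> pathfinish \<gamma> = y}"

definition complete_metric :: "(complex^'n) set \<Rightarrow> 'n metric \<Rightarrow> bool" where
  "complete_metric U G \<longleftrightarrow>
     (\<forall>s::nat \<Rightarrow> complex^'n.
        (\<forall>k. s k \<in> U) \<and> (\<forall>e>0. \<exists>N. \<forall>k\<ge>N. \<forall>l\<ge>N. metric_dist U G (s k) (s l) < e)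
        \<longrightarrow> (\<exists>x\<in>U. (\<lambda>k. metric_dist U G (s k) x) \<longlonglongrightarrow> 0))"

definition complete_kahler_metric :: "(complex^'n) set \<Rightarrow> 'n metric \<Rightarrow> bool" where
  "complete_kahler_metric U G \<longleftrightarrow> kahler_metric U G \<and> complete_metric U G"


section \<open>The Grauert metric and the metrics attached to holomorphic functions\<close>

definition grauert_u :: "real \<Rightarrow> real" where
  "grauert_u t = (if t = 1 then 1 else (t - 1) / (t * ln t))"

definition grauert_metric :: "complex \<Rightarrow> real" where
  "grauert_metric w = 1 + (norm w)\<^sup>2 * (grauert_u ((norm w)\<^sup>2))\<^sup>2"

text \<open>The pullback $f^*(g|dw|^2)$ under a holomorphic function \<open>f\<close>.\<close>

definition pullback_conformal ::
  "(complex^'n \<Rightarrow> complex) \<Rightarrow> (complex \<Rightarrow> real) \<Rightarrow> 'n metric" where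
  "pullback_conformal f g z = (\<chi> i j. of_real (g (f z)) * wirt i f z * cnj (wirt j f z))"

definition divisor_metric :: "'n metric \<Rightarrow> (complex^'n \<Rightarrow> complex) \<Rightarrow> 'n metric" where
  "divisor_metric \<Phi> f z = pullback_conformal f grauert_metric z + \<Phi> z"


section \<open>Curvatures\<close>

definition dT :: "(complex \<Rightarrow> complex) \<Rightarrow> complex \<Rightarrow> complex" where
  "dT h T = (frechet_derivative h (at T) 1 - \<i> * frechet_derivative h (at T) \<i>) / 2"

definition dT_bar :: "(complex \<Rightarrow> complex) \<Rightarrow> complex \<Rightarrow> complex" where
  "dT_bar h T = (frechet_derivative h (at T) 1 + \<i> * frechet_derivative h (at T) \<i>) / 2"

definition gauss_curvature :: "(complex \<Rightarrow> real) \<Rightarrow> complex \<Rightarrow> real" where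
  "gauss_curvature h T =
     (let hc = (\<lambda>S. complex_of_real (h S)) in
      Re (- 2 * inverse (hc T ^ 3) * (hc T * dT (dT_bar hc) T - dT hc T * dT_bar hc T)))"

text \<open>\<open>Z\<close> parametrizes, near \<open>q\<close>, the leaf through \<open>q\<close> of the foliation on \<open>N\<close> induced by \<open>X\<close>.\<close>

definition leaf_param ::
  "(complex^'n) set \<Rightarrow> (complex^'n \<Rightarrow> complex^'n) \<Rightarrow> complex^'n \<Rightarrow> real \<Rightarrow> (complex \<Rightarrow> complex^'n) \<Rightarrow> bool" where
  "leaf_param N X q \<epsilon> Z \<longleftrightarrow> \<epsilon> > 0 \<and> Z 0 = q \<and>
     (\<forall>T\<in>ball 0 \<epsilon>. Z T \<in> N \<and>
        (\<forall>i. ((\<lambda>S. Z S $ i) has_field_derivative X (Z T) $ i) (at T)))"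

text \<open>
  The pullback $Z^*\phi$ is $\phi(X(Z(T)),X(Z(T)))\,|dT|^2$. The value does not depend on \<open>Z\<close>, as
  the germ of \<open>Z\<close> is determined by \<open>q\<close> and \<open>X\<close>.
\<close>

definition leaf_curvature ::
  "(complex^'n) set \<Rightarrow> (complex^'n \<Rightarrow> complex^'n) \<Rightarrow> 'n metric \<Rightarrow> complex^'n \<Rightarrow> real" where
  "leaf_curvature N X \<phi> q =
     (THE \<kappa>. \<exists>\<epsilon> Z. leaf_param N X q \<epsilon> Z \<and>
        \<kappa> = gauss_curvature (\<lambda>T. norm_sq (\<phi> (Z T)) (X (Z T))) 0)"

text \<open>
  $R_{i\bar jk\bar l} = -\partial_k\partial_{\bar l}g_{i\bar j}
    + g^{\bar qp}\,\partial_k g_{i\bar q}\,\partial_{\bar l}g_{p\bar j}$, where $g^{\bar qp}$ is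
  the entry of the inverse matrix in row \<open>q\<close> and column \<open>p\<close>.
\<close>

definition curvature_tensor :: "'n metric \<Rightarrow> complex^'n \<Rightarrow> 'n \<Rightarrow> 'n \<Rightarrow> 'n \<Rightarrow> 'n \<Rightarrow> complex" where
  "curvature_tensor G z i j k l =
     - wirt k (wirt_bar l (\<lambda>x. G x $ i $ j)) z
     + (\<Sum>p\<in>UNIV. \<Sum>q\<in>UNIV. matrix_inv (G z) $ q $ p *
          wirt k (\<lambda>x. G x $ i $ q) z * wirt_bar l (\<lambda>x. G x $ p $ j) z)"

text \<open>
  The factor 2 makes this the Gaussian curvature for $n = 1$, where
  $R_{1\bar11\bar1} = -h^{-1}(h\,\partial\bar\partial h - \partial h\,\bar\partial h)$.
\<close>

definition hol_sect_curvature :: "'n metric \<Rightarrow> complex^'n \<Rightarrow> complex^'n \<Rightarrow> real" where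
  "hol_sect_curvature G p V =
     2 * Re (\<Sum>i\<in>UNIV. \<Sum>j\<in>UNIV. \<Sum>k\<in>UNIV. \<Sum>l\<in>UNIV.
               curvature_tensor G p i j k l * V $ i * cnj (V $ j) * V $ k * cnj (V $ l))
       / (norm_sq (G p) V)\<^sup>2"

end

theory Submission
  imports Defs "HOL-Complex_Analysis.Cauchy_Integral_Formula"
begin

text \<open>
  Both curvatures are continuous functions of finitely many derivatives, at the point in question,
  of the coefficients of the metric. By the Cauchy estimates, locally uniform convergence of the
  \<open>f j\<close> entails convergence of all their derivatives, hence of the jets of the metrics near any
  point where \<open>f0\<close> does not vanish. The Grauert metric causes no trouble there, since it is a
  holomorphic function of $w\bar w$ on the right half plane. So the inequality for the
  holomorphic sectional curvature is in fact an equality of limits.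
  The leaf curvature is computed along a fixed integral curve \<open>Z\<close> of the vector field, along which
  the metrics become conformal metrics in one variable.
\<close>

section \<open>Locally uniform limits and derivatives of holomorphic functions\<close>

text \<open>Holomorphy here only asserts a complex linear derivative at each point, without
  continuity of that derivative, so the regularity of derivatives has to be proved. This is done by
  restriction to complex lines \<open>z + t *s v\<close>, where Cauchy's inequality in one variable
  is available. Two derivatives of \<open>f j\<close> must converge, since the coefficients already
  contain \<open>wirt i (f j)\<close> and the curvatures differentiate them once more in unbarred
  and barred directions. The obstacle is that the coefficients are of mixed type: products of
  holomorphic functions, conjugates of such functions and the Grauert factor, plus a merely smooth
  coefficient of \<Phi>. This suggests a notion of convergent jet that is closed under sums,
  products and holomorphic substitution, so that each kind of factor is treated once. The same
  notion serves on C^n and on a leaf, where only the pair of directions changes.\<close>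

lemma norm_vector_smult: "norm (c *s v) = cmod c * norm (v :: complex^'n)"
  by (simp add: norm_vec_def norm_mult L2_set_right_distrib)

lemma holo_on_has_derivative:
  assumes "holo_on U f" "z \<in> U"
  shows "(f has_derivative frechet_derivative f (at z)) (at z)"
  using assms unfolding holo_on_def
  by (metis frechet_derivative_at)

lemma holo_on_frechet_smult:
  assumes "holo_on U f" "z \<in> U"
  shows "frechet_derivative f (at z) (c *s v) = c * frechet_derivative f (at z) v"
  using assms unfolding holo_on_def
  by (metis frechet_derivative_at)

lemma holo_on_subset: "holo_on U f \<Longrightarrow> V \<subseteq> U \<Longrightarrow> holo_on V f"
  unfolding holo_on_def by blast

lemma holo_on_imp_continuous_on: "holo_on U f \<Longrightarrow> continuous_on U f"
  by (meson continuous_at_imp_continuous_on has_derivative_continuous holo_on_has_derivative)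

lemma holo_on_diff:
  assumes "holo_on U f" "holo_on U g"
  shows "holo_on U (\<lambda>z. f z - g z)"
  unfolding holo_on_def
proof
  fix z assume z: "z \<in> U"
  show "\<exists>L. ((\<lambda>z. f z - g z) has_derivative L) (at z) \<and> (\<forall>c v. L (c *s v) = c * L v)"
    by (rule exI[of _ "\<lambda>v. frechet_derivative f (at z) v - frechet_derivative g (at z) v"])
      (auto intro!: has_derivative_diff holo_on_has_derivative[OF assms(1) z]
        holo_on_has_derivative[OF assms(2) z]
        simp: holo_on_frechet_smult[OF assms(1) z] holo_on_frechet_smult[OF assms(2) z] algebra_simps)
qed

lemma holo_on_const: "holo_on U (\<lambda>_. c)"
  unfolding holo_on_def by (auto intro!: exI[of _ "\<lambda>_. 0"])

lemma holo_on_coord: "holo_on U (\<lambda>z. z $ i)"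
  unfolding holo_on_def
  by (auto intro!: exI[of _ "\<lambda>v. v $ i"] bounded_linear_imp_has_derivative bounded_linear_vec_nth)

lemma holo_on_add:
  assumes "holo_on U f" "holo_on U g"
  shows "holo_on U (\<lambda>z. f z + g z)"
  unfolding holo_on_def
proof
  fix z assume z: "z \<in> U"
  show "\<exists>L. ((\<lambda>z. f z + g z) has_derivative L) (at z) \<and> (\<forall>c v. L (c *s v) = c * L v)"
    by (rule exI[of _ "\<lambda>v. frechet_derivative f (at z) v + frechet_derivative g (at z) v"])
      (auto intro!: has_derivative_add holo_on_has_derivative[OF assms(1) z]
        holo_on_has_derivative[OF assms(2) z]
        simp: holo_on_frechet_smult[OF assms(1) z] holo_on_frechet_smult[OF assms(2) z] algebra_simps)
qed

lemma holo_on_mult: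
  assumes "holo_on U f" "holo_on U g"
  shows "holo_on U (\<lambda>z. f z * g z)"
  unfolding holo_on_def
proof
  fix z assume z: "z \<in> U"
  show "\<exists>L. ((\<lambda>z. f z * g z) has_derivative L) (at z) \<and> (\<forall>c v. L (c *s v) = c * L v)"
    by (rule exI, rule conjI, rule has_derivative_mult[OF holo_on_has_derivative[OF assms(1) z] holo_on_has_derivative[OF assms(2) z]])
      (simp add: holo_on_frechet_smult[OF assms(1) z] holo_on_frechet_smult[OF assms(2) z] algebra_simps)
qed

lemma holo_on_sum:
  assumes "\<And>i. i \<in> I \<Longrightarrow> holo_on U (f i)"
  shows "holo_on U (\<lambda>z. \<Sum>i\<in>I. f i z)"
  using assms by (induction I rule: infinite_finite_induct) (auto intro: holo_on_const holo_on_add)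

section \<open>Restriction to complex lines and Cauchy estimates\<close>

lemma bounded_linear_smult_left: "bounded_linear (\<lambda>t. t *s v)" for v :: "complex^'n"
  by (rule bounded_linear_intro[where K="norm v"])
     (auto simp: norm_vector_smult vec_eq_iff algebra_simps)

lemma has_derivative_line: "((\<lambda>t. z + t *s v) has_derivative (\<lambda>t. t *s v)) (at t0)"
  for v :: "complex^'n"
  by (auto intro!: derivative_eq_intros bounded_linear_imp_has_derivative bounded_linear_smult_left)

text \<open>Complex linearity of the derivative is what makes the restriction to a complex line
  complex differentiable in \<open>t\<close>; one-variable theory enters here.\<close>

lemma has_field_derivative_line:
  assumes "holo_on U f" "z + t *s v \<in> U"
  shows "((\<lambda>t. f (z + t *s v)) has_field_derivative frechet_derivative f (at (z + t *s v)) v) (at t)"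
proof -
  have "((\<lambda>t. f (z + t *s v)) has_derivative (\<lambda>s. frechet_derivative f (at (z + t *s v)) (s *s v))) (at t)"
    using has_derivative_compose[OF has_derivative_line holo_on_has_derivative[OF assms]] .
  then show ?thesis
    unfolding has_field_derivative_def holo_on_frechet_smult[OF assms]
    by (simp add: mult_commute_abs)
qed

lemma line_in_ball:
  fixes v :: "complex^'n"
  assumes "v \<noteq> 0" "t \<in> ball 0 (r / norm v)"
  shows "z + t *s v \<in> ball z r"
  using assms by (simp add: norm_vector_smult dist_norm field_simps)

lemma line_holomorphic_on:
  assumes "holo_on (ball z r) f" "v \<noteq> 0"
  shows "(\<lambda>t. f (z + t *s v)) holomorphic_on ball 0 (r / norm v)"
  unfolding holomorphic_on_open[OF open_ball]
  using has_field_derivative_line[OF assms(1)] line_in_ball[OF assms(2)] by blast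

text \<open>Cauchy's inequality asks for continuity up to the boundary circle, while only the open
  ball is controlled. It is therefore applied on radii \<open>s < r\<close>, and \<open>s\<close>
  then tends to \<open>r\<close>.\<close>

lemma Cauchy_higher_deriv_bound_ball:
  assumes "f holomorphic_on ball z r" "\<And>w. w \<in> ball z r \<Longrightarrow> cmod (f w) \<le> M" "0 < r"
  shows "cmod ((deriv ^^ n) f z) \<le> fact n * M / r ^ n"
proof (rule tendsto_lowerbound)
  show "((\<lambda>s. fact n * M / s ^ n) \<longlongrightarrow> fact n * M / r ^ n) (at_left r)"
    using \<open>0 < r\<close> by (intro tendsto_intros) auto
  show "\<forall>\<^sub>F s in at_left r. cmod ((deriv ^^ n) f z) \<le> fact n * M / s ^ n"
    using eventually_at_left_real[OF \<open>0 < r\<close>]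
  proof eventually_elim
    case (elim s)
    have sub: "cball z s \<subseteq> ball z r" using elim by auto
    show ?case
    proof (rule Cauchy_inequality)
      show "f holomorphic_on ball z s"
        using assms(1) by (rule holomorphic_on_subset) (use elim in auto)
      show "continuous_on (cball z s) f"
        using assms(1) sub holomorphic_on_imp_continuous_on continuous_on_subset by blast
      show "cmod (f w) \<le> M" if "cmod (z - w) = s" for w
        by (rule assms(2)) (use that elim in \<open>auto simp: dist_norm\<close>)
    qed (use elim in auto)
  qed
qed auto

lemma frechet_derivative_zero_vec:
  "f differentiable at z \<Longrightarrow> frechet_derivative f (at z) 0 = 0"
  by (simp add: linear_frechet_derivative linear_0)

lemma holo_on_differentiable: "holo_on U f \<Longrightarrow> z \<in> U \<Longrightarrow> f differentiable at z"
  by (meson holo_on_has_derivative differentiable_def)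

text \<open>The line through \<open>z\<close> in direction \<open>v\<close> stays in the ball for
  \<open>t\<close> in the disc of radius \<open>r / norm v\<close>; the one-variable Cauchy
  inequality on that disc produces the factor \<open>norm v / r\<close>.\<close>

lemma holo_on_Cauchy_estimate:
  assumes f: "holo_on (ball z r) f" and M: "\<And>w. w \<in> ball z r \<Longrightarrow> cmod (f w) \<le> M" and r: "0 < r"
  shows "cmod (frechet_derivative f (at z) v) \<le> M / r * norm v"
proof (cases "v = 0")
  case True
  then show ?thesis
    using frechet_derivative_zero_vec[OF holo_on_differentiable[OF f]] r by simp
next
  case False
  have *: "((\<lambda>t. f (z + t *s v)) has_field_derivative frechet_derivative f (at z) v) (at 0)"
    using has_field_derivative_line[OF f, of z 0 v] r by simp
  have "cmod ((deriv ^^ 1) (\<lambda>t. f (z + t *s v)) 0) \<le> fact 1 * M / (r / norm v) ^ 1"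
    by (rule Cauchy_higher_deriv_bound_ball[OF line_holomorphic_on[OF f False]])
       (use False r in \<open>auto intro!: M line_in_ball simp del: mem_ball\<close>)
  then show ?thesis
    using False DERIV_imp_deriv[OF *] by simp
qed

text \<open>First order Taylor expansion along a complex line. The bound is uniform in
  \<open>z\<close> as long as \<open>r\<close> and \<open>M\<close> are, which is what makes
  difference quotients converge uniformly.\<close>

lemma holo_on_difference_quotient:
  assumes f: "holo_on (ball z r) f" and M: "\<And>w. w \<in> ball z r \<Longrightarrow> cmod (f w) \<le> M" and r: "0 < r"
    and h: "2 * cmod h * norm v < r"
  shows "cmod (f (z + h *s v) - f z - h * frechet_derivative f (at z) v) \<le> 8 * M * (norm v / r)\<^sup>2 * (cmod h)\<^sup>2"
proof (cases "v = 0")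
  case True
  then show ?thesis
    using frechet_derivative_zero_vec[OF holo_on_differentiable[OF f]] r by simp
next
  case False
  define u where "u = (\<lambda>t. f (z + t *s v))"
  define \<rho> where "\<rho> = r / norm v"
  have \<rho>: "\<rho> > 0" using False r by (simp add: \<rho>_def)
  have hol: "u holomorphic_on ball 0 \<rho>"
    unfolding u_def \<rho>_def by (rule line_holomorphic_on[OF f False])
  have bnd: "cmod (u t) \<le> M" if "t \<in> ball 0 \<rho>" for t
    using M line_in_ball[OF False] that by (simp add: u_def \<rho>_def)
  have d0: "deriv u 0 = frechet_derivative f (at z) v"
    using has_field_derivative_line[OF f, of z 0 v] r by (simp add: DERIV_imp_deriv u_def)
  have "cmod ((deriv ^^ 0) u h - (\<Sum>i\<le>1. (deriv ^^ i) u 0 * (h - 0) ^ i / fact i))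
          \<le> (8 * M / \<rho>\<^sup>2) * cmod (h - 0) ^ Suc 1 / fact 1"
  \<comment> \<open>On the half disc, discs of radius \<open>\<rho>/2\<close> around every point
    still lie in the full disc, so the second derivative is at most 2! M / (\<rho>/2)^2 = 8 M /
    \<rho>^2. The hypothesis on \<open>h\<close> places it in the half disc.\<close>
  proof (rule complex_Taylor[where S="ball 0 (\<rho>/2)"])
    show "((deriv ^^ i) u has_field_derivative (deriv ^^ Suc i) u t) (at t within ball 0 (\<rho>/2))"
      if "t \<in> ball 0 (\<rho>/2)" "i \<le> 1" for i t
    proof -
      have "(deriv ^^ i) u holomorphic_on ball 0 \<rho>"
        by (rule holomorphic_higher_deriv[OF hol open_ball])
      then show ?thesis
        using holomorphic_derivI[of "(deriv ^^ i) u" "ball 0 \<rho>" t] that \<rho> by auto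
    qed
    show "cmod ((deriv ^^ Suc 1) u t) \<le> 8 * M / \<rho>\<^sup>2" if "t \<in> ball 0 (\<rho>/2)" for t
    proof -
      have sub: "ball t (\<rho>/2) \<subseteq> ball 0 \<rho>"
      proof
        fix x assume "x \<in> ball t (\<rho>/2)"
        then show "x \<in> ball 0 \<rho>" using that norm_triangle_ineq[of t "x - t"]
          by (simp add: dist_norm norm_minus_commute)
      qed
      have "cmod ((deriv ^^ 2) u t) \<le> fact 2 * M / (\<rho>/2) ^ 2"
        by (rule Cauchy_higher_deriv_bound_ball) (use sub hol bnd \<rho> holomorphic_on_subset in auto)
      also have "fact 2 * M / (\<rho>/2) ^ 2 = 8 * M / \<rho>\<^sup>2"
        by (simp add: power2_eq_square)
      finally show ?thesis by (simp add: numeral_2_eq_2)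
    qed
  qed (use False r h \<rho> in \<open>auto simp: \<rho>_def field_simps\<close>)
  then show ?thesis
    using False r by (simp add: u_def[symmetric] d0[symmetric] power_divide \<rho>_def power2_eq_square mult.commute)
      (simp add: u_def field_simps)
qed

section \<open>Weierstrass convergence in several variables and holomorphy of derivatives\<close>

lemma ball_subset_ball_interior:
  assumes "x \<in> ball z s" shows "ball x (r - s) \<subseteq> ball (z::'a::metric_space) r"
proof
  fix y assume "y \<in> ball x (r - s)"
  then show "y \<in> ball z r"
    using assms dist_triangle[of z y x] by auto
qed

text \<open>The Cauchy estimate for \<open>f - g\<close> on the ball of radius \<open>r - s\<close>
  around \<open>x\<close>. The bound does not depend on \<open>x\<close> and is linear in
  \<open>norm v\<close>, hence an operator norm bound.\<close>

lemma holo_on_frechet_uniform_Cauchy: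
  fixes f g :: "complex^'n \<Rightarrow> complex"
  assumes "holo_on (ball z r) f" "holo_on (ball z r) g" "s < r"
    and "\<And>w. w \<in> ball z r \<Longrightarrow> cmod (f w - g w) \<le> M" "x \<in> ball z s"
  shows "cmod (frechet_derivative f (at x) v - frechet_derivative g (at x) v) \<le> M / (r - s) * norm v"
proof -
  have sub: "ball x (r - s) \<subseteq> ball z r" by (rule ball_subset_ball_interior[OF assms(5)])
  have x: "x \<in> ball z r" using assms(3,5) by auto
  have "((\<lambda>w. f w - g w) has_derivative (\<lambda>v. frechet_derivative f (at x) v - frechet_derivative g (at x) v)) (at x)"
    by (intro has_derivative_diff holo_on_has_derivative[OF _ x] assms)
  then have "frechet_derivative (\<lambda>w. f w - g w) (at x) v =
      frechet_derivative f (at x) v - frechet_derivative g (at x) v"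
    by (simp add: frechet_derivative_at[symmetric])
  moreover have "cmod (frechet_derivative (\<lambda>w. f w - g w) (at x) v) \<le> M / (r - s) * norm v"
    by (rule holo_on_Cauchy_estimate)
       (use assms sub in \<open>auto intro: holo_on_subset[OF holo_on_diff]\<close>)
  ultimately show ?thesis by simp
qed

text \<open>Used with \<open>t = norm v\<close>: dividing by \<open>t + 1\<close> gives a strict
  bound without a separate case \<open>v = 0\<close>.\<close>

lemma div_Suc_times_less:
  fixes e t :: real
  assumes "0 < e" "0 \<le> t"
  shows "e / (t + 1) * t < e"
proof -
  have "e * t < e * (t + 1)" using assms by simp
  then have "e * t / (t + 1) < e" using assms by (simp add: pos_divide_less_eq)
  then show ?thesis by simp
qed

lemma holo_on_uniform_limit_frechet:
  assumes f: "\<And>n. holo_on (ball z r) (f n)" and g: "holo_on (ball z r) g"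
    and lim: "uniform_limit (ball z r) f g sequentially" and s: "s < r"
  shows "uniform_limit (ball z s) (\<lambda>n x. frechet_derivative (f n) (at x) v)
           (\<lambda>x. frechet_derivative g (at x) v) sequentially"
proof (rule uniform_limitI)
  fix e :: real assume e: "e > 0"
  define d where "d = (r - s) * (e / (norm v + 1))"
  have d: "d > 0" using e s by (simp add: d_def add_nonneg_pos)
  have de: "d / (r - s) * norm v < e"
    using div_Suc_times_less[OF e norm_ge_zero[of v]] s by (simp add: d_def)
  show "\<forall>\<^sub>F n in sequentially. \<forall>x\<in>ball z s. dist (frechet_derivative (f n) (at x) v) (frechet_derivative g (at x) v) < e"
    using uniform_limitD[OF lim d]
  proof eventually_elim
    case (elim n)
    show ?case
    proof
      fix x assume x: "x \<in> ball z s"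
      have "cmod (f n w - g w) \<le> d" if "w \<in> ball z r" for w
        using elim that by (auto simp: dist_norm intro: less_imp_le)
      from holo_on_frechet_uniform_Cauchy[OF f g s this x, of v] de
      show "dist (frechet_derivative (f n) (at x) v) (frechet_derivative g (at x) v) < e"
        by (simp add: dist_norm)
    qed
  qed
qed

text \<open>The derivatives are uniformly Cauchy in operator norm on smaller balls, so the sequence
  may be differentiated termwise; complex linearity passes to the pointwise limit of the
  derivatives.\<close>

lemma holo_on_uniform_limit:
  assumes f: "\<And>n. holo_on (ball z r) (f n)"
    and lim: "uniform_limit (ball z r) f g sequentially" 
  shows "holo_on (ball z r) g"
  unfolding holo_on_def
proof
  fix y assume y: "y \<in> ball z r"
  \<comment> \<open>The radius midway between \<open>dist z y\<close> and \<open>r\<close> keeps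
    \<open>y\<close> inside and leaves a margin \<open>r - s\<close> for the Cauchy
    estimate.\<close>
  define s where "s = (dist z y + r) / 2"
  have s: "s < r" "y \<in> ball z s" using y by (auto simp: s_def)
  define F where "F = (\<lambda>n x. frechet_derivative (f n) (at x))"
  define g' where "g' = (\<lambda>x v. lim (\<lambda>n. F n x v))"
  have C: "\<exists>N. \<forall>m\<ge>N. \<forall>n\<ge>N. \<forall>x\<in>ball z s. \<forall>v. cmod (F n x v - F m x v) \<le> e * norm v"
    if e: "e > 0" for e
  proof -
    have "uniformly_Cauchy_on (ball z r) f"
      using lim uniformly_convergent_Cauchy uniformly_convergent_on_def by blast
    moreover have "e * (r - s) > 0" using e s by auto
    ultimately obtain N where N: "\<And>x m n. x \<in> ball z r \<Longrightarrow> m \<ge> N \<Longrightarrow> n \<ge> N \<Longrightarrow> dist (f m x) (f n x) < e * (r - s)"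
      unfolding uniformly_Cauchy_on_def by metis
    have "cmod (F n x v - F m x v) \<le> e * norm v" if "m \<ge> N" "n \<ge> N" "x \<in> ball z s" for m n x v
      using holo_on_frechet_uniform_Cauchy[OF f[of n] f[of m] s(1), of "e * (r - s)" x v] N that s
      by (simp add: F_def dist_norm less_imp_le)
    then show ?thesis by blast
  qed
  have conv: "(\<lambda>n. F n x v) \<longlonglongrightarrow> g' x v" if x: "x \<in> ball z s" for x v
  proof -
    have "Cauchy (\<lambda>n. F n x v)"
      unfolding Cauchy_def
    proof (intro allI impI)
      fix e :: real assume e: "e > 0"
      have "e / (norm v + 1) > 0" using e by (simp add: add_nonneg_pos)
      from C[OF this] obtain N where N: "\<And>m n. m \<ge> N \<Longrightarrow> n \<ge> N \<Longrightarrow> cmod (F n x v - F m x v) \<le> e / (norm v + 1) * norm v"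
        using x by blast
      have "e / (norm v + 1) * norm v < e"
        by (rule div_Suc_times_less[OF e norm_ge_zero])
      then have "dist (F m x v) (F n x v) < e" if "m \<ge> N" "n \<ge> N" for m n
        using N[OF that(2,1)] by (simp add: dist_norm)
      then show "\<exists>M. \<forall>m\<ge>M. \<forall>n\<ge>M. dist (F m x v) (F n x v) < e" by blast
    qed
    then show ?thesis
      unfolding g'_def by (simp add: Cauchy_convergent convergent_LIMSEQ_iff[symmetric])
  qed
  have ptw: "(\<lambda>n. f n x) \<longlonglongrightarrow> g x" if "x \<in> ball z s" for x
    by (rule tendsto_uniform_limitI[OF lim]) (use that s in auto)
  have "\<exists>G. \<forall>x\<in>ball z s. (\<lambda>n. f n x) \<longlonglongrightarrow> G x \<and> (G has_derivative g' x) (at x within ball z s)"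
  proof (rule has_derivative_sequence)
    show "(f n has_derivative F n x) (at x within ball z s)" if "x \<in> ball z s" for n x
      unfolding F_def by (rule has_derivative_at_withinI, rule holo_on_has_derivative[OF f]) (use that s in auto)
    show "\<forall>\<^sub>F n in sequentially. \<forall>x\<in>ball z s. \<forall>v. cmod (F n x v - g' x v) \<le> e * norm v" if "e > 0" for e
    proof -
      obtain N where N: "\<And>m n x v. m \<ge> N \<Longrightarrow> n \<ge> N \<Longrightarrow> x \<in> ball z s \<Longrightarrow> cmod (F n x v - F m x v) \<le> e * norm v"
        using C[OF \<open>e > 0\<close>] by blast
      \<comment> \<open>The index \<open>N\<close> is uniform in \<open>x\<close> and
        \<open>v\<close>, so the Cauchy bound survives the limit in \<open>m\<close>.\<close>
      have "cmod (F n x v - g' x v) \<le> e * norm v" if "n \<ge> N" "x \<in> ball z s" for n x v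
      proof (rule tendsto_upperbound)
        show "(\<lambda>m. cmod (F n x v - F m x v)) \<longlonglongrightarrow> cmod (F n x v - g' x v)"
          by (intro tendsto_intros conv that)
        show "\<forall>\<^sub>F m in sequentially. cmod (F n x v - F m x v) \<le> e * norm v"
          using eventually_ge_at_top[of N] by eventually_elim (use N that in blast)
      qed auto
      then show ?thesis unfolding eventually_sequentially by blast
    qed
  qed (use s ptw in auto)
  then obtain G where G: "\<And>x. x \<in> ball z s \<Longrightarrow> (\<lambda>n. f n x) \<longlonglongrightarrow> G x"
    "\<And>x. x \<in> ball z s \<Longrightarrow> (G has_derivative g' x) (at x within ball z s)" by blast
  \<comment> \<open>Termwise differentiation only supplies some limit function \<open>G\<close>; it
    has to be identified with \<open>g\<close>.\<close>
  have Gg: "G x = g x" if "x \<in> ball z s" for x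
    using LIMSEQ_unique[OF G(1) ptw] that by blast
  have "(g has_derivative g' y) (at y within ball z s)"
    by (rule has_derivative_transform[OF s(2) _ G(2)[OF s(2)]]) (simp add: Gg)
  then have "(g has_derivative g' y) (at y)"
    by (simp only: at_within_open[OF s(2) open_ball])
  moreover have "g' y (c *s v) = c * g' y v" for c v
  proof (rule LIMSEQ_unique[OF conv[OF s(2)]])
    have "F n y (c *s v) = c * F n y v" for n
      unfolding F_def by (rule holo_on_frechet_smult[OF f y])
    then show "(\<lambda>n. F n y (c *s v)) \<longlonglongrightarrow> c * g' y v"
      by (simp only:) (intro tendsto_intros conv[OF s(2)])
  qed
  ultimately show "\<exists>L. (g has_derivative L) (at y) \<and> (\<forall>c v. L (c *s v) = c * L v)" by blast
qed

text \<open>Difference quotients in the direction \<open>v\<close> are holomorphic, and by the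
  quadratic Taylor remainder they converge locally uniformly to the derivative. The limit theorem
  above then makes the derivative holomorphic, with no prior knowledge of its continuity.\<close>

lemma holo_on_frechet_derivative:
  assumes f: "holo_on U f" and U: "open U"
  shows "holo_on U (\<lambda>z. frechet_derivative f (at z) v)"
proof -
  have "\<exists>r>0. holo_on (ball z0 r) (\<lambda>z. frechet_derivative f (at z) v)" if z0: "z0 \<in> U" for z0
  proof -
    obtain R where R: "R > 0" "cball z0 R \<subseteq> U" using U z0 open_contains_cball by blast
    have "compact (f ` cball z0 R)"
      by (rule compact_continuous_image[OF continuous_on_subset[OF holo_on_imp_continuous_on[OF f] R(2)]]) auto
    then obtain M where M: "\<And>w. w \<in> cball z0 R \<Longrightarrow> cmod (f w) \<le> M"
      using compact_imp_bounded bounded_iff by (metis imageI)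
    \<comment> \<open>Half of \<open>R\<close>: both the shifted points and the balls of radius
      \<open>r\<close> around points of \<open>ball z0 r\<close> stay in \<open>cball z0 R\<close>,
      where \<open>f\<close> is bounded by \<open>M\<close>.\<close>
    define r where "r = R / 2"
    have r: "r > 0" using R by (simp add: r_def)
    \<comment> \<open>Real increments tending to 0, scaled so that
      \<open>2 * h n * norm v < r\<close>, as the Taylor estimate demands; the \<open>+ 1\<close>
      covers \<open>v = 0\<close>.\<close>
    define h :: "nat \<Rightarrow> real" where "h = (\<lambda>n. r / (4 * (norm v + 1)) / real (Suc n))"
    have h0: "h n > 0" for n using r by (simp add: h_def add_nonneg_pos)
    have hlim: "h \<longlonglongrightarrow> 0"
      unfolding h_def by (rule LIMSEQ_Suc[OF lim_const_over_n])
    have hv: "2 * h n * norm v < r" for n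
    proof -
      have "h n \<le> r / (4 * (norm v + 1)) / 1"
        unfolding h_def by (rule divide_left_mono) (use r in \<open>auto simp: add_nonneg_pos\<close>)
      then have "2 * h n * norm v \<le> 2 * (r / (4 * (norm v + 1))) * norm v"
        by (intro mult_right_mono) auto
      also have "\<dots> < r"
        using r by (simp add: divide_simps add_nonneg_pos)
      finally show ?thesis .
    qed
    define q where "q = (\<lambda>n z. (f (z + of_real (h n) *s v) - f z) / of_real (h n))"
    have inU: "z + of_real (h n) *s v \<in> U" if "z \<in> ball z0 r" for n z
    proof -
      have "norm (of_real (h n) *s v) < r"
        using hv[of n] h0[of n] mult_nonneg_nonneg[of "h n" "norm v"] r 
        by (simp add: norm_vector_smult)
      then have "z + of_real (h n) *s v \<in> ball z0 R"
        using that dist_triangle[of z0 "z + of_real (h n) *s v" z] by (simp add: dist_norm r_def)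
      then show ?thesis using R by auto
    qed
    have qholo: "holo_on (ball z0 r) (q n)" for n
      unfolding holo_on_def
    proof
      fix z assume z: "z \<in> ball z0 r"
      have zU: "z \<in> U" using z R by (auto simp: r_def)
      let ?L = "\<lambda>w. (frechet_derivative f (at (z + of_real (h n) *s v)) w - frechet_derivative f (at z) w) / of_real (h n)"
      have "((\<lambda>z. f (z + of_real (h n) *s v)) has_derivative frechet_derivative f (at (z + of_real (h n) *s v))) (at z)"
      proof -
        have "((\<lambda>z. z + of_real (h n) *s v) has_derivative (\<lambda>w. w)) (at z)"
          by (auto intro!: derivative_eq_intros)
        from has_derivative_compose[OF this holo_on_has_derivative[OF f inU[OF z]]] show ?thesis .
      qed
      then have "(q n has_derivative ?L) (at z)"
        unfolding q_def divide_inverse using holo_on_has_derivative[OF f zU]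
        by (auto intro!: derivative_eq_intros simp: mult.commute)
      moreover have "?L (c *s w) = c * ?L w" for c w
        using holo_on_frechet_smult[OF f zU] holo_on_frechet_smult[OF f inU[OF z]]
        by (simp add: algebra_simps)
      ultimately show "\<exists>L. (q n has_derivative L) (at z) \<and> (\<forall>c v. L (c *s v) = c * L v)" by blast
    qed
    have "uniform_limit (ball z0 r) q (\<lambda>z. frechet_derivative f (at z) v) sequentially"
    proof (rule uniform_limitI)
      fix e :: real assume e: "e > 0"
      have "(\<lambda>n. 8 * M * (norm v / r)\<^sup>2 * h n) \<longlonglongrightarrow> 8 * M * (norm v / r)\<^sup>2 * 0"
        by (intro tendsto_intros hlim)
      then have "\<forall>\<^sub>F n in sequentially. 8 * M * (norm v / r)\<^sup>2 * h n < e"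
        using e order_tendstoD(2) by fastforce
      then show "\<forall>\<^sub>F n in sequentially. \<forall>z\<in>ball z0 r. dist (q n z) (frechet_derivative f (at z) v) < e"
      proof eventually_elim
        case (elim n)
        show ?case
        proof
          fix z assume z: "z \<in> ball z0 r"
          have sub: "ball z r \<subseteq> cball z0 R"
            using ball_subset_ball_interior[OF z, of R] by (auto simp: r_def)
          have "cmod (f (z + of_real (h n) *s v) - f z - of_real (h n) * frechet_derivative f (at z) v)
             \<le> 8 * M * (norm v / r)\<^sup>2 * (cmod (of_real (h n)))\<^sup>2"
            by (rule holo_on_difference_quotient)
               (use sub R M r h0 hv in \<open>auto intro: holo_on_subset[OF f] simp: less_imp_le\<close>)
          also have "f (z + of_real (h n) *s v) - f z - of_real (h n) * frechet_derivative f (at z) v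
              = of_real (h n) * (q n z - frechet_derivative f (at z) v)"
            using h0[of n] by (simp add: q_def field_simps)
          finally have "h n * cmod (q n z - frechet_derivative f (at z) v) \<le> h n * (8 * M * (norm v / r)\<^sup>2 * h n)"
            using h0[of n] by (simp add: norm_mult power2_eq_square mult_ac)
          then have "cmod (q n z - frechet_derivative f (at z) v) \<le> 8 * M * (norm v / r)\<^sup>2 * h n"
            using h0[of n] by simp
          then show "dist (q n z) (frechet_derivative f (at z) v) < e"
            using elim by (simp add: dist_norm)
        qed
      qed
    qed
    from holo_on_uniform_limit[OF qholo this] r show ?thesis by (intro exI[of _ r] conjI)
  qed
  note local = this
  show ?thesis
    unfolding holo_on_def
  proof
    fix z0 assume "z0 \<in> U"
    from local[OF this] obtain r where "r > 0" "holo_on (ball z0 r) (\<lambda>z. frechet_derivative f (at z) v)"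
      by blast
    then show "\<exists>L. ((\<lambda>z. frechet_derivative f (at z) v) has_derivative L) (at z0) \<and> (\<forall>c w. L (c *s w) = c * L w)"
      by (metis centre_in_ball holo_on_frechet_smult holo_on_has_derivative)
  qed
qed

section \<open>Second order jets\<close>

text \<open>
  A pair \<open>a\<close> of tangent vectors stands for $(v, iv)$; \<open>wd a\<close> and \<open>wdbar a\<close> are then the Wirtinger
  derivatives in the complex direction $v$. This covers coordinate directions in $C^n$ and the
  one-variable operators of \<^const>\<open>gauss_curvature\<close> alike.
\<close>

definition wder :: "complex \<Rightarrow> 'a::real_normed_vector \<times> 'a \<Rightarrow> ('a \<Rightarrow> complex) \<Rightarrow> 'a \<Rightarrow> complex" where
  "wder c a f x = (frechet_derivative f (at x) (fst a) + c * frechet_derivative f (at x) (snd a)) / 2"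

abbreviation "wd \<equiv> wder (-\<i>)"
abbreviation "wdbar \<equiv> wder \<i>"

lemma wirt_eq_wder: "wirt k = wd (axis k 1, axis k \<i>)" "wirt_bar k = wdbar (axis k 1, axis k \<i>)"
  by (simp_all add: fun_eq_iff wirt_def wirt_bar_def wder_def)

lemma dT_eq_wder: "dT = wd (1, \<i>)" "dT_bar = wdbar (1, \<i>)"
  by (simp_all add: fun_eq_iff dT_def dT_bar_def wder_def)

lemma wder_eqI: "(f has_derivative L) (at x) \<Longrightarrow> wder c a f x = (L (fst a) + c * L (snd a)) / 2"
  by (simp add: wder_def frechet_derivative_at[symmetric])

section \<open>Locality and differentiation rules for Wirtinger derivatives\<close>

lemma has_derivative_cong_nhds:
  assumes "\<forall>\<^sub>F y in nhds x. f y = g y" "(f has_derivative L) (at x)"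
  shows "(g has_derivative L) (at x)"
  by (rule has_derivative_transform_eventually[OF assms(2)])
     (use assms(1) eventually_nhds_x_imp_x[OF assms(1)] in \<open>simp_all add: eventually_nhds_conv_at\<close>)

lemma frechet_derivative_cong:
  assumes "\<forall>\<^sub>F y in nhds x. f y = g y"
  shows "frechet_derivative f (at x) = frechet_derivative g (at x)"
proof -
  have "\<forall>\<^sub>F y in nhds x. g y = f y" using assms by (auto elim: eventually_mono)
  then have "(f has_derivative L) (at x) \<longleftrightarrow> (g has_derivative L) (at x)" for L
    using assms has_derivative_cong_nhds by blast
  then show ?thesis by (simp add: frechet_derivative_def)
qed

lemma differentiable_cong_nhds:
  assumes "\<forall>\<^sub>F y in nhds x. f y = g y" "f differentiable at x"
  shows "g differentiable at x"
  using assms has_derivative_cong_nhds unfolding differentiable_def by blast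

text \<open>Agreement near \<open>x\<close> is agreement near every point close to \<open>x\<close>.
  The conclusion on a whole neighbourhood is needed because \<open>wdbar b f\<close> is
  differentiated again.\<close>

lemma wder_cong_nhds:
  assumes "\<forall>\<^sub>F y in nhds x. f y = g y"
  shows "\<forall>\<^sub>F y in nhds x. wder c a f y = wder c a g y"
  using assms[THEN eventually_eventually[THEN iffD2]]
  by eventually_elim (simp add: wder_def frechet_derivative_cong)

lemmas frechet_derivative_worksI = frechet_derivative_works[THEN iffD1]

lemma wder_cong: "\<forall>\<^sub>F y in nhds x. f y = g y \<Longrightarrow> wder c a f x = wder c a g x"
  using wder_cong_nhds eventually_nhds_x_imp_x by blast

lemma wder_const: "wder c a (\<lambda>_. k) x = 0"
  by (simp add: wder_def)

lemma wder_add: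
  assumes "f differentiable at x" "g differentiable at x"
  shows "wder c a (\<lambda>y. f y + g y) x = wder c a f x + wder c a g x"
  by (subst wder_eqI[OF has_derivative_add[OF assms[THEN frechet_derivative_worksI]]])
     (simp add: wder_def field_simps)

lemma wder_mult:
  assumes "f differentiable at x" "g differentiable at x"
  shows "wder c a (\<lambda>y. f y * g y) x = wder c a f x * g x + f x * wder c a g x"
  by (subst wder_eqI[OF has_derivative_mult[OF assms[THEN frechet_derivative_worksI]]])
     (simp add: wder_def field_simps)

lemma comp_has_derivative:
  assumes "(\<gamma> has_field_derivative d) (at (f x))" "f differentiable at x"
  shows "((\<lambda>y. \<gamma> (f y)) has_derivative (\<lambda>v. d * frechet_derivative f (at x) v)) (at x)"
  using has_derivative_compose[OF assms(2)[THEN frechet_derivative_worksI] assms(1)[unfolded has_field_derivative_def]]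
  .

lemma wder_comp:
  assumes "(\<gamma> has_field_derivative d) (at (f x))" "f differentiable at x"
  shows "wder c a (\<lambda>y. \<gamma> (f y)) x = d * wder c a f x"
  by (subst wder_eqI[OF comp_has_derivative[OF assms]]) (simp add: wder_def field_simps)

text \<open>
  \<open>jet_conv a b x f f0\<close> records exactly what the curvatures see of a coefficient \<open>f j\<close>. The
  neighbourhood of \<open>x\<close> on which \<open>f j\<close> is differentiable may depend on \<open>j\<close>.
\<close>

definition twice_diff :: "'a::real_normed_vector \<times> 'a \<Rightarrow> ('a \<Rightarrow> complex) \<Rightarrow> 'a \<Rightarrow> bool" where
  "twice_diff b f x \<longleftrightarrow> (\<forall>\<^sub>F y in nhds x. f differentiable at y) \<and> wdbar b f differentiable at x"

definition jet_conv :: "'a::real_normed_vector \<times> 'a \<Rightarrow> 'a \<times> 'a \<Rightarrow> 'a \<Rightarrow> (nat \<Rightarrow> 'a \<Rightarrow> complex) \<Rightarrow> ('a \<Rightarrow> complex) \<Rightarrow> bool" where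
  "jet_conv a b x f f0 \<longleftrightarrow>
     (\<forall>\<^sub>F j in sequentially. twice_diff b (f j) x) \<and> twice_diff b f0 x \<and>
     (\<lambda>j. f j x) \<longlonglongrightarrow> f0 x \<and>
     (\<lambda>j. wd a (f j) x) \<longlonglongrightarrow> wd a f0 x \<and>
     (\<lambda>j. wdbar b (f j) x) \<longlonglongrightarrow> wdbar b f0 x \<and>
     (\<lambda>j. wd a (wdbar b (f j)) x) \<longlonglongrightarrow> wd a (wdbar b f0) x"

lemma twice_diffD:
  assumes "twice_diff b f x"
  shows "f differentiable at x" "\<forall>\<^sub>F y in nhds x. f differentiable at y" "wdbar b f differentiable at x"
  using assms eventually_nhds_x_imp_x unfolding twice_diff_def by blast+

lemma twice_diff_cong:
  assumes "\<forall>\<^sub>F y in nhds x. f y = g y" "twice_diff b f x"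
  shows "twice_diff b g x"
proof -
  have "\<forall>\<^sub>F y in nhds x. g differentiable at y"
    using assms(1)[THEN eventually_eventually[THEN iffD2]] twice_diffD(2)[OF assms(2)]
    by eventually_elim (rule differentiable_cong_nhds)
  moreover have "wdbar b g differentiable at x"
    using differentiable_cong_nhds[OF wder_cong_nhds[OF assms(1)] twice_diffD(3)[OF assms(2)]] .
  ultimately show ?thesis by (simp add: twice_diff_def)
qed

text \<open>The neighbourhood of agreement may shrink with \<open>j\<close>. This admits identities
  that hold only where \<open>f j\<close> does not vanish.\<close>

lemma jet_conv_cong:
  assumes f: "\<forall>\<^sub>F j in sequentially. \<forall>\<^sub>F y in nhds x. f j y = g j y"
    and f0: "\<forall>\<^sub>F y in nhds x. f0 y = g0 y" and "jet_conv a b x f f0"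
  shows "jet_conv a b x g g0"
proof -
  note J = assms(3)[unfolded jet_conv_def]
  have e0: "f0 x = g0 x" "wd a f0 x = wd a g0 x" "wdbar b f0 x = wdbar b g0 x"
    "wd a (wdbar b f0) x = wd a (wdbar b g0) x"
    using f0 eventually_nhds_x_imp_x wder_cong[OF f0] wder_cong[OF wder_cong_nhds[OF f0]] by blast+
  have ev: "\<forall>\<^sub>F j in sequentially. f j x = g j x \<and> wd a (f j) x = wd a (g j) x \<and> wdbar b (f j) x = wdbar b (g j) x
      \<and> wd a (wdbar b (f j)) x = wd a (wdbar b (g j)) x"
    using f by eventually_elim
      (auto intro: wder_cong wder_cong_nhds dest: eventually_nhds_x_imp_x)
  show ?thesis
    unfolding jet_conv_def
  proof (intro conjI)
    show "\<forall>\<^sub>F j in sequentially. twice_diff b (g j) x"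
      using f conjunct1[OF J] by eventually_elim (rule twice_diff_cong)
    show "twice_diff b g0 x" using twice_diff_cong[OF f0] J by blast
  qed (rule Lim_transform_eventually, use J e0 in simp, use ev in \<open>auto elim!: eventually_mono\<close>)+
qed

section \<open>Calculus of convergent jets\<close>

lemma jet_conv_const_seq: "twice_diff b f x \<Longrightarrow> jet_conv a b x (\<lambda>_. f) f"
  by (simp add: jet_conv_def)

lemma jet_conv_const: "jet_conv a b x (\<lambda>_ _. k) (\<lambda>_. k)"
  by (rule jet_conv_const_seq) (simp add: twice_diff_def wder_const[abs_def])

lemma twice_diff_add:
  assumes "twice_diff b f x" "twice_diff b g x"
  shows "\<forall>\<^sub>F y in nhds x. wdbar b (\<lambda>y. f y + g y) y = wdbar b f y + wdbar b g y"
    "twice_diff b (\<lambda>y. f y + g y) x"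
    "wd a (wdbar b (\<lambda>y. f y + g y)) x = wd a (wdbar b f) x + wd a (wdbar b g) x"
proof -
  show *: "\<forall>\<^sub>F y in nhds x. wdbar b (\<lambda>y. f y + g y) y = wdbar b f y + wdbar b g y"
    using twice_diffD(2)[OF assms(1)] twice_diffD(2)[OF assms(2)] by eventually_elim (rule wder_add)
  have "\<forall>\<^sub>F y in nhds x. (\<lambda>y. f y + g y) differentiable at y"
    using twice_diffD(2)[OF assms(1)] twice_diffD(2)[OF assms(2)] by eventually_elim (rule differentiable_add)
  moreover have "wdbar b (\<lambda>y. f y + g y) differentiable at x"
    by (rule differentiable_cong_nhds[where f="\<lambda>y. wdbar b f y + wdbar b g y"])
       (use * in \<open>auto elim: eventually_mono intro!: differentiable_add twice_diffD(3) assms\<close>)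
  ultimately show "twice_diff b (\<lambda>y. f y + g y) x"
    by (simp add: twice_diff_def)
  show "wd a (wdbar b (\<lambda>y. f y + g y)) x = wd a (wdbar b f) x + wd a (wdbar b g) x"
    unfolding wder_cong[OF *] by (intro wder_add twice_diffD(3) assms)
qed

text \<open>The mixed derivative of a product pairs \<open>wd\<close> of one factor with
  \<open>wdbar\<close> of the other; hence both first derivatives have to be recorded in
  \<open>jet_conv\<close>.\<close>

lemma twice_diff_mult:
  assumes "twice_diff b f x" "twice_diff b g x"
  shows "\<forall>\<^sub>F y in nhds x. wdbar b (\<lambda>y. f y * g y) y = wdbar b f y * g y + f y * wdbar b g y"
    "twice_diff b (\<lambda>y. f y * g y) x"
    "wd a (wdbar b (\<lambda>y. f y * g y)) x =
       (wd a (wdbar b f) x * g x + wdbar b f x * wd a g x) + (wd a f x * wdbar b g x + f x * wd a (wdbar b g) x)"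
proof -
  note d = twice_diffD(1,3)[OF assms(1)] twice_diffD(1,3)[OF assms(2)]
  show *: "\<forall>\<^sub>F y in nhds x. wdbar b (\<lambda>y. f y * g y) y = wdbar b f y * g y + f y * wdbar b g y"
    using twice_diffD(2)[OF assms(1)] twice_diffD(2)[OF assms(2)] by eventually_elim (rule wder_mult)
  have "\<forall>\<^sub>F y in nhds x. (\<lambda>y. f y * g y) differentiable at y"
    using twice_diffD(2)[OF assms(1)] twice_diffD(2)[OF assms(2)] by eventually_elim (rule differentiable_mult)
  moreover have "wdbar b (\<lambda>y. f y * g y) differentiable at x"
    by (rule differentiable_cong_nhds[where f="\<lambda>y. wdbar b f y * g y + f y * wdbar b g y"])
       (use * in \<open>auto elim: eventually_mono intro!: differentiable_add differentiable_mult d\<close>)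
  ultimately show "twice_diff b (\<lambda>y. f y * g y) x"
    by (simp add: twice_diff_def)
  show "wd a (wdbar b (\<lambda>y. f y * g y)) x =
       (wd a (wdbar b f) x * g x + wdbar b f x * wd a g x) + (wd a f x * wdbar b g x + f x * wd a (wdbar b g) x)"
    unfolding wder_cong[OF *] by (simp add: wder_add wder_mult d differentiable_mult)
qed

lemma jet_conv_add:
  assumes f: "jet_conv a b x f f0" and g: "jet_conv a b x g g0"
  shows "jet_conv a b x (\<lambda>j y. f j y + g j y) (\<lambda>y. f0 y + g0 y)"
proof -
  note J = f[unfolded jet_conv_def] g[unfolded jet_conv_def]
  have ev: "\<forall>\<^sub>F j in sequentially. twice_diff b (f j) x \<and> twice_diff b (g j) x"
    using J by (simp add: eventually_conj_iff)
  note eqs = twice_diff_add eventually_nhds_x_imp_x[OF twice_diff_add(1)] wder_add[OF twice_diffD(1)[of b] twice_diffD(1)[of b]]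
  show ?thesis
    unfolding jet_conv_def
  proof (intro conjI)
    show "\<forall>\<^sub>F j in sequentially. twice_diff b (\<lambda>y. f j y + g j y) x"
      using ev by eventually_elim (simp add: eqs)
    show "twice_diff b (\<lambda>y. f0 y + g0 y) x" using J by (simp add: eqs)
    show "(\<lambda>j. f j x + g j x) \<longlonglongrightarrow> f0 x + g0 x"
      using J by (intro tendsto_intros) auto
    show "(\<lambda>j. wd a (\<lambda>y. f j y + g j y) x) \<longlonglongrightarrow> wd a (\<lambda>y. f0 y + g0 y) x"
    proof (rule Lim_transform_eventually)
      show "(\<lambda>j. wd a (f j) x + wd a (g j) x) \<longlonglongrightarrow> wd a (\<lambda>y. f0 y + g0 y) x"
        using J by (simp add: eqs tendsto_add)
    qed (use ev in \<open>auto elim!: eventually_mono simp: eqs\<close>)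
    show "(\<lambda>j. wdbar b (\<lambda>y. f j y + g j y) x) \<longlonglongrightarrow> wdbar b (\<lambda>y. f0 y + g0 y) x"
    proof (rule Lim_transform_eventually)
      show "(\<lambda>j. wdbar b (f j) x + wdbar b (g j) x) \<longlonglongrightarrow> wdbar b (\<lambda>y. f0 y + g0 y) x"
        using J by (simp add: eqs tendsto_add)
    qed (use ev in \<open>auto elim!: eventually_mono simp: eqs\<close>)
    show "(\<lambda>j. wd a (wdbar b (\<lambda>y. f j y + g j y)) x) \<longlonglongrightarrow> wd a (wdbar b (\<lambda>y. f0 y + g0 y)) x"
    proof (rule Lim_transform_eventually)
      show "(\<lambda>j. wd a (wdbar b (f j)) x + wd a (wdbar b (g j)) x) \<longlonglongrightarrow> wd a (wdbar b (\<lambda>y. f0 y + g0 y)) x"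
        using J by (simp add: eqs tendsto_add)
    qed (use ev in \<open>auto elim!: eventually_mono simp: eqs\<close>)
  qed
qed

text \<open>Each limit is that of the corresponding Leibniz formula. The formula is available only
  for the indices with \<open>twice_diff\<close>, that is for large \<open>j\<close>, so the limits
  are transferred along eventual equality.\<close>

lemma jet_conv_mult:
  assumes f: "jet_conv a b x f f0" and g: "jet_conv a b x g g0"
  shows "jet_conv a b x (\<lambda>j y. f j y * g j y) (\<lambda>y. f0 y * g0 y)"
proof -
  note J = f[unfolded jet_conv_def] g[unfolded jet_conv_def]
  have ev: "\<forall>\<^sub>F j in sequentially. twice_diff b (f j) x \<and> twice_diff b (g j) x"
    using J by (simp add: eventually_conj_iff)
  note eqs = twice_diff_mult eventually_nhds_x_imp_x[OF twice_diff_mult(1)] wder_mult[OF twice_diffD(1)[of b] twice_diffD(1)[of b]]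
  show ?thesis
    unfolding jet_conv_def
  proof (intro conjI)
    show "\<forall>\<^sub>F j in sequentially. twice_diff b (\<lambda>y. f j y * g j y) x"
      using ev by eventually_elim (simp add: eqs)
    show "twice_diff b (\<lambda>y. f0 y * g0 y) x" using J by (simp add: eqs)
    show "(\<lambda>j. f j x * g j x) \<longlonglongrightarrow> f0 x * g0 x"
      using J by (intro tendsto_intros) auto
    show "(\<lambda>j. wd a (\<lambda>y. f j y * g j y) x) \<longlonglongrightarrow> wd a (\<lambda>y. f0 y * g0 y) x"
    proof (rule Lim_transform_eventually)
      show "(\<lambda>j. wd a (f j) x * g j x + f j x * wd a (g j) x) \<longlonglongrightarrow> wd a (\<lambda>y. f0 y * g0 y) x"
        using J by (simp add: eqs tendsto_add tendsto_mult)
    qed (use ev in \<open>auto elim!: eventually_mono simp: eqs\<close>)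
    show "(\<lambda>j. wdbar b (\<lambda>y. f j y * g j y) x) \<longlonglongrightarrow> wdbar b (\<lambda>y. f0 y * g0 y) x"
    proof (rule Lim_transform_eventually)
      show "(\<lambda>j. wdbar b (f j) x * g j x + f j x * wdbar b (g j) x) \<longlonglongrightarrow> wdbar b (\<lambda>y. f0 y * g0 y) x"
        using J by (simp add: eqs tendsto_add tendsto_mult)
    qed (use ev in \<open>auto elim!: eventually_mono simp: eqs\<close>)
    show "(\<lambda>j. wd a (wdbar b (\<lambda>y. f j y * g j y)) x) \<longlonglongrightarrow> wd a (wdbar b (\<lambda>y. f0 y * g0 y)) x"
    proof (rule Lim_transform_eventually)
      show "(\<lambda>j. (wd a (wdbar b (f j)) x * g j x + wdbar b (f j) x * wd a (g j) x) +
            (wd a (f j) x * wdbar b (g j) x + f j x * wd a (wdbar b (g j)) x)) \<longlonglongrightarrow> wd a (wdbar b (\<lambda>y. f0 y * g0 y)) x"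
        using J by (simp add: eqs tendsto_add tendsto_mult)
    qed (use ev in \<open>auto elim!: eventually_mono simp: eqs\<close>)
  qed
qed

lemma jet_conv_sum:
  assumes "\<And>i. i \<in> I \<Longrightarrow> jet_conv a b x (f i) (f0 i)"
  shows "jet_conv a b x (\<lambda>j y. \<Sum>i\<in>I. f i j y) (\<lambda>y. \<Sum>i\<in>I. f0 i y)"
  using assms
  by (induction I rule: infinite_finite_induct) (auto intro!: jet_conv_const jet_conv_add)

text \<open>Holomorphy of \<open>\<gamma>\<close> keeps the chain rule to a single term:
  \<open>wd\<close> and \<open>wdbar\<close> of the composite never meet a conjugate derivative of
  \<open>\<gamma>\<close>.\<close>

lemma twice_diff_comp:
  assumes f: "twice_diff b f x" and \<gamma>: "\<gamma> holomorphic_on S" and S: "open S" "f x \<in> S"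
  shows "\<forall>\<^sub>F y in nhds x. wdbar b (\<lambda>y. \<gamma> (f y)) y = deriv \<gamma> (f y) * wdbar b f y"
    "twice_diff b (\<lambda>y. \<gamma> (f y)) x"
    "wd a (\<lambda>y. \<gamma> (f y)) x = deriv \<gamma> (f x) * wd a f x"
    "wd a (wdbar b (\<lambda>y. \<gamma> (f y))) x =
       deriv (deriv \<gamma>) (f x) * wd a f x * wdbar b f x + deriv \<gamma> (f x) * wd a (wdbar b f) x"
proof -
  note d = twice_diffD(1,3)[OF f]
  have g1: "(\<gamma> has_field_derivative deriv \<gamma> w) (at w)" if "w \<in> S" for w
    using holomorphic_derivI[OF \<gamma> S(1) that] .
  have g2: "(deriv \<gamma> has_field_derivative deriv (deriv \<gamma>) w) (at w)" if "w \<in> S" for w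
    using holomorphic_derivI[OF holomorphic_deriv[OF \<gamma> S(1)] S(1) that] .
  have "(f \<longlongrightarrow> f x) (nhds x)"
    using d(1) differentiable_imp_continuous_within[OF d(1)] by (simp add: isCont_def tendsto_nhds_iff)
  then have inS: "\<forall>\<^sub>F y in nhds x. f y \<in> S"
    using S topological_tendstoD by blast
  show *: "\<forall>\<^sub>F y in nhds x. wdbar b (\<lambda>y. \<gamma> (f y)) y = deriv \<gamma> (f y) * wdbar b f y"
    using inS twice_diffD(2)[OF f] by eventually_elim (rule wder_comp[OF g1])
  have dd: "(\<lambda>y. deriv \<gamma> (f y)) differentiable at x"
    using comp_has_derivative[OF g2[OF S(2)] d(1)] unfolding differentiable_def by blast
  have "\<forall>\<^sub>F y in nhds x. (\<lambda>y. \<gamma> (f y)) differentiable at y"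
    using inS twice_diffD(2)[OF f]
  proof eventually_elim
    case (elim y)
    then show ?case using comp_has_derivative[OF g1] unfolding differentiable_def by blast
  qed
  moreover have "wdbar b (\<lambda>y. \<gamma> (f y)) differentiable at x"
    by (rule differentiable_cong_nhds[where f="\<lambda>y. deriv \<gamma> (f y) * wdbar b f y"])
       (use * in \<open>auto elim: eventually_mono intro!: differentiable_mult d dd\<close>)
  ultimately show "twice_diff b (\<lambda>y. \<gamma> (f y)) x"
    by (simp add: twice_diff_def)
  show "wd a (\<lambda>y. \<gamma> (f y)) x = deriv \<gamma> (f x) * wd a f x"
    by (rule wder_comp[OF g1[OF S(2)] d(1)])
  show "wd a (wdbar b (\<lambda>y. \<gamma> (f y))) x =
       deriv (deriv \<gamma>) (f x) * wd a f x * wdbar b f x + deriv \<gamma> (f x) * wd a (wdbar b f) x"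
    unfolding wder_cong[OF *] by (simp add: wder_mult dd d wder_comp[OF g2[OF S(2)] d(1)])
qed

text \<open>The formulas for the composite involve \<open>\<gamma>\<close> and its first two
  derivatives at \<open>f j x\<close>. All three are continuous on \<open>S\<close>, which contains
  \<open>f j x\<close> for large \<open>j\<close>.\<close>

lemma jet_conv_comp:
  assumes f: "jet_conv a b x f f0" and \<gamma>: "\<gamma> holomorphic_on S" and S: "open S" "f0 x \<in> S"
  shows "jet_conv a b x (\<lambda>j y. \<gamma> (f j y)) (\<lambda>y. \<gamma> (f0 y))"
proof -
  note J = f[unfolded jet_conv_def]
  have ev: "\<forall>\<^sub>F j in sequentially. twice_diff b (f j) x \<and> f j x \<in> S"
    using J topological_tendstoD[of _ "f0 x" sequentially S] S by (simp add: eventually_conj_iff)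
  note eqs = twice_diff_comp[where b=b, OF _ \<gamma> S(1)] eventually_nhds_x_imp_x[OF twice_diff_comp(1)[OF _ \<gamma> S(1)]]
  have h: "\<gamma> holomorphic_on S" "deriv \<gamma> holomorphic_on S" "deriv (deriv \<gamma>) holomorphic_on S"
    using \<gamma> S holomorphic_deriv by blast+
  have c: "isCont h (f0 x)" if "h holomorphic_on S" for h
    using that S holomorphic_on_imp_continuous_on continuous_on_eq_continuous_at by blast
  have fl: "(\<lambda>j. f j x) \<longlonglongrightarrow> f0 x" using J by blast
  note lim = isCont_tendsto_compose[OF c[OF h(1)] fl] isCont_tendsto_compose[OF c[OF h(2)] fl]
    isCont_tendsto_compose[OF c[OF h(3)] fl]
  show ?thesis
    unfolding jet_conv_def
  proof (intro conjI)
    show "\<forall>\<^sub>F j in sequentially. twice_diff b (\<lambda>y. \<gamma> (f j y)) x"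
      using ev by eventually_elim (simp add: eqs)
    show "twice_diff b (\<lambda>y. \<gamma> (f0 y)) x" using J S by (simp add: eqs)
    show "(\<lambda>j. \<gamma> (f j x)) \<longlonglongrightarrow> \<gamma> (f0 x)" by (rule lim)
    show "(\<lambda>j. wd a (\<lambda>y. \<gamma> (f j y)) x) \<longlonglongrightarrow> wd a (\<lambda>y. \<gamma> (f0 y)) x"
    proof (rule Lim_transform_eventually)
      show "(\<lambda>j. deriv \<gamma> (f j x) * wd a (f j) x) \<longlonglongrightarrow> wd a (\<lambda>y. \<gamma> (f0 y)) x"
        using J S by (simp add: eqs(3) tendsto_add tendsto_mult lim)
    qed (use ev in \<open>auto elim!: eventually_mono simp: eqs(3)\<close>)
    show "(\<lambda>j. wdbar b (\<lambda>y. \<gamma> (f j y)) x) \<longlonglongrightarrow> wdbar b (\<lambda>y. \<gamma> (f0 y)) x"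
    proof (rule Lim_transform_eventually)
      show "(\<lambda>j. deriv \<gamma> (f j x) * wdbar b (f j) x) \<longlonglongrightarrow> wdbar b (\<lambda>y. \<gamma> (f0 y)) x"
        using J S by (simp add: eqs(5) tendsto_add tendsto_mult lim)
    qed (use ev in \<open>auto elim!: eventually_mono simp: eqs(5)\<close>)
    show "(\<lambda>j. wd a (wdbar b (\<lambda>y. \<gamma> (f j y))) x) \<longlonglongrightarrow> wd a (wdbar b (\<lambda>y. \<gamma> (f0 y))) x"
    proof (rule Lim_transform_eventually)
      show "(\<lambda>j. deriv (deriv \<gamma>) (f j x) * wd a (f j) x * wdbar b (f j) x + deriv \<gamma> (f j x) * wd a (wdbar b (f j)) x)
        \<longlonglongrightarrow> wd a (wdbar b (\<lambda>y. \<gamma> (f0 y))) x"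
        using J S by (simp add: eqs(4) tendsto_add tendsto_mult lim)
    qed (use ev in \<open>auto elim!: eventually_mono simp: eqs(4)\<close>)
  qed
qed

section \<open>Jets of holomorphic functions and of their conjugates\<close>

text \<open>The Cauchy-Riemann equation in a single complex direction, for a pair \<open>a\<close>
  of the form (v, iv). Stated by direction, it applies to coordinates of C^n and to the parameter of
  a leaf.\<close>

definition cr_at :: "'a::real_normed_vector \<times> 'a \<Rightarrow> ('a \<Rightarrow> complex) \<Rightarrow> 'a \<Rightarrow> bool" where
  "cr_at a f x \<longleftrightarrow> f differentiable at x \<and>
     frechet_derivative f (at x) (snd a) = \<i> * frechet_derivative f (at x) (fst a)"

lemma cr_at_wder:
  assumes "cr_at a f x"
  shows "wdbar a f x = 0" "wd a f x = frechet_derivative f (at x) (fst a)"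
  using assms by (simp_all add: cr_at_def wder_def)

lemma has_derivative_cnj_comp:
  assumes "f differentiable at x"
  shows "((\<lambda>y. cnj (f y)) has_derivative (\<lambda>v. cnj (frechet_derivative f (at x) v))) (at x)"
  by (rule bounded_linear.has_derivative[OF bounded_linear_cnj frechet_derivative_worksI[OF assms]])

lemma cr_at_wder_cnj:
  assumes "cr_at a f x"
  shows "wd a (\<lambda>y. cnj (f y)) x = 0" "wdbar a (\<lambda>y. cnj (f y)) x = cnj (frechet_derivative f (at x) (fst a))"
  using assms by (simp_all add: cr_at_def wder_eqI[OF has_derivative_cnj_comp])

text \<open>Here \<open>wdbar\<close> vanishes near \<open>x\<close>, so the mixed derivatives are
  all 0 and only values and first derivatives have to converge.\<close>

lemma jet_conv_holo:
  assumes cr: "\<And>j. \<forall>\<^sub>F y in nhds x. cr_at b (f j) y" "\<forall>\<^sub>F y in nhds x. cr_at b f0 y"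
    and cra: "\<And>j. cr_at a (f j) x" "cr_at a f0 x"
    and lim: "(\<lambda>j. f j x) \<longlonglongrightarrow> f0 x"
      "(\<lambda>j. frechet_derivative (f j) (at x) (fst a)) \<longlonglongrightarrow> frechet_derivative f0 (at x) (fst a)"
  shows "jet_conv a b x f f0"
proof -
  have *: "twice_diff b f x \<and> wdbar b f x = 0 \<and> wd a (wdbar b f) x = 0" if cr: "\<forall>\<^sub>F y in nhds x. cr_at b f y" for f
  proof -
    have e: "\<forall>\<^sub>F y in nhds x. wdbar b f y = 0"
      using cr by eventually_elim (rule cr_at_wder)
    then have "\<forall>\<^sub>F y in nhds x. 0 = wdbar b f y"
      by eventually_elim simp
    then have "wdbar b f differentiable at x"
      by (rule differentiable_cong_nhds) simp
    moreover have "\<forall>\<^sub>F y in nhds x. f differentiable at y"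
      using cr by eventually_elim (simp add: cr_at_def)
    ultimately show ?thesis
      using eventually_nhds_x_imp_x[OF e] wder_cong[OF e] by (simp add: twice_diff_def wder_const)
  qed
  show ?thesis
    unfolding jet_conv_def using *[OF cr(1)] *[OF cr(2)] lim by (simp add: cr_at_wder[OF cra(1)] cr_at_wder[OF cra(2)])
qed

text \<open>The barred derivative of a conjugate is the conjugate of the holomorphic derivative. It
  is killed by \<open>wd\<close> because that derivative satisfies the Cauchy-Riemann equation too,
  which is the purpose of \<open>cra'\<close>.\<close>

lemma jet_conv_cnj:
  assumes cr: "\<And>j. \<forall>\<^sub>F y in nhds x. cr_at b (f j) y" "\<forall>\<^sub>F y in nhds x. cr_at b f0 y"
    and cra: "\<And>j. cr_at a (f j) x" "cr_at a f0 x"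
    and cra': "\<And>j. cr_at a (\<lambda>y. frechet_derivative (f j) (at y) (fst b)) x"
       "cr_at a (\<lambda>y. frechet_derivative f0 (at y) (fst b)) x"
    and lim: "(\<lambda>j. f j x) \<longlonglongrightarrow> f0 x"
      "(\<lambda>j. frechet_derivative (f j) (at x) (fst b)) \<longlonglongrightarrow> frechet_derivative f0 (at x) (fst b)"
  shows "jet_conv a b x (\<lambda>j y. cnj (f j y)) (\<lambda>y. cnj (f0 y))"
proof -
  have *: "twice_diff b (\<lambda>y. cnj (f y)) x \<and> wdbar b (\<lambda>y. cnj (f y)) x = cnj (frechet_derivative f (at x) (fst b))
      \<and> wd a (wdbar b (\<lambda>y. cnj (f y))) x = 0" if cr: "\<forall>\<^sub>F y in nhds x. cr_at b f y"
    and cra: "cr_at a (\<lambda>y. frechet_derivative f (at y) (fst b)) x" for f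
  proof -
    have e: "\<forall>\<^sub>F y in nhds x. wdbar b (\<lambda>y. cnj (f y)) y = cnj (frechet_derivative f (at y) (fst b))"
      using cr by eventually_elim (rule cr_at_wder_cnj)
    have "(\<lambda>y. cnj (frechet_derivative f (at y) (fst b))) differentiable at x"
      using has_derivative_cnj_comp[of "\<lambda>y. frechet_derivative f (at y) (fst b)" x] cra
      unfolding differentiable_def cr_at_def by blast
    then have "wdbar b (\<lambda>y. cnj (f y)) differentiable at x"
      by (rule differentiable_cong_nhds[rotated]) (use e in eventually_elim, simp)
    moreover have "\<forall>\<^sub>F y in nhds x. (\<lambda>y. cnj (f y)) differentiable at y"
      using cr
    proof eventually_elim
      case (elim y)
      then show ?case using has_derivative_cnj_comp[of f y]
        unfolding differentiable_def cr_at_def by blast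
    qed
    ultimately show ?thesis
      using eventually_nhds_x_imp_x[OF e] wder_cong[OF e] cr_at_wder_cnj(1)[OF cra] by (simp add: twice_diff_def)
  qed
  show ?thesis
    unfolding jet_conv_def using *[OF cr(1) cra'(1)] *[OF cr(2) cra'(2)] lim
    by (simp add: cr_at_wder_cnj[OF cra(1)] cr_at_wder_cnj[OF cra(2)] tendsto_cnj)
qed

section \<open>The Grauert metric as a holomorphic function of $w\bar w$\<close>

text \<open>The function Ln z / (z - 1) with its singularity at 1 filled in, written in the shape of
  the removable singularity theorem \<open>pole_lemma_open\<close>.\<close>

definition log_quotient :: "complex \<Rightarrow> complex" where
  "log_quotient z = (if z = 1 then deriv Ln 1 else (Ln z - Ln 1) / (z - 1))"

text \<open>For t > 0 the inverse of \<open>z * log_quotient z\<close> at t is u(t), so this extends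
  1 + t u(t)^2 holomorphically from the positive axis.\<close>

definition grauert_ext :: "complex \<Rightarrow> complex" where
  "grauert_ext z = 1 + z * (inverse (z * log_quotient z))\<^sup>2"

lemma deriv_Ln_1: "deriv Ln 1 = 1"
  by (rule DERIV_imp_deriv) (auto intro!: derivative_eq_intros)

lemma grauert_ext_holomorphic: "grauert_ext holomorphic_on {z. 0 < Re z}"
proof -
  have "Ln holomorphic_on {z. 0 < Re z}"
    by (rule holomorphic_on_Ln) (auto simp: complex_nonpos_Reals_iff)
  from pole_lemma_open[OF this, of 1] have "log_quotient holomorphic_on {z. 0 < Re z}"
    unfolding log_quotient_def[abs_def] by (simp add: open_halfspace_Re_gt)
  \<comment> \<open>A zero with \<open>z \<noteq> 1\<close> would force \<open>Ln z = 0\<close>,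
    hence z = exp 0 = 1; at 1 the filled-in value is 1.\<close>
  moreover have "log_quotient z \<noteq> 0" if "0 < Re z" for z
  proof -
    have "Ln z \<noteq> 0" if "z \<noteq> 1"
      using that \<open>0 < Re z\<close> exp_Ln[of z] by force
    then show ?thesis by (simp add: log_quotient_def deriv_Ln_1)
  qed
  ultimately show ?thesis
    unfolding grauert_ext_def[abs_def] by (intro holomorphic_intros) auto
qed

lemma grauert_ext_eq:
  assumes "w \<noteq> 0"
  shows "grauert_ext (w * cnj w) = of_real (grauert_metric w)"
proof -
  define t where "t = (cmod w)\<^sup>2"
  have t: "t > 0" using assms by (simp add: t_def)
  have w: "w * cnj w = of_real t" unfolding t_def by (rule complex_norm_square[symmetric])
  have "log_quotient (of_real t) = of_real (if t = 1 then 1 else ln t / (t - 1))"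
    using t by (auto simp: log_quotient_def deriv_Ln_1 Ln_of_real)
  then have "inverse (of_real t * log_quotient (of_real t)) = of_real (grauert_u t)"
    by (auto simp: grauert_u_def divide_inverse)
  then show ?thesis
    unfolding w grauert_ext_def grauert_metric_def t_def[symmetric] by simp
qed

text \<open>Written as \<open>grauert_ext (f * cnj f)\<close>, the Grauert factor is a holomorphic
  substitution into a product whose two factors have convergent jets. At a zero of \<open>f\<close>
  the product would leave the right half plane, whence the condition on \<open>f0 x\<close>.\<close>

lemma jet_conv_grauert:
  assumes "jet_conv a b x f f0" "jet_conv a b x (\<lambda>j y. cnj (f j y)) (\<lambda>y. cnj (f0 y))" "f0 x \<noteq> 0"
  shows "jet_conv a b x (\<lambda>j y. of_real (grauert_metric (f j y))) (\<lambda>y. of_real (grauert_metric (f0 y)))"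
proof (rule jet_conv_cong)
  show "jet_conv a b x (\<lambda>j y. grauert_ext (f j y * cnj (f j y))) (\<lambda>y. grauert_ext (f0 y * cnj (f0 y)))"
    by (rule jet_conv_comp[OF jet_conv_mult[OF assms(1,2)] grauert_ext_holomorphic])
       (use assms(3) in \<open>simp_all add: open_halfspace_Re_gt complex_norm_square[symmetric] del: of_real_power\<close>)
  \<comment> \<open>Continuity keeps \<open>g\<close> away from 0 near \<open>x\<close>, where the
    extension and the metric factor agree.\<close>
  have *: "\<forall>\<^sub>F y in nhds x. grauert_ext (g y * cnj (g y)) = of_real (grauert_metric (g y))"
    if "twice_diff b g x" "g x \<noteq> 0" for g
  proof -
    have "(g \<longlongrightarrow> g x) (nhds x)"
      using differentiable_imp_continuous_within[OF twice_diffD(1)[OF that(1)]] by (simp add: isCont_def tendsto_nhds_iff)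
    from tendsto_imp_eventually_ne[OF this that(2)] show ?thesis
      by eventually_elim (rule grauert_ext_eq)
  qed
  show "\<forall>\<^sub>F y in nhds x. grauert_ext (f0 y * cnj (f0 y)) = of_real (grauert_metric (f0 y))"
    using assms(1)[unfolded jet_conv_def] assms(3) by (intro *) simp_all
  have "\<forall>\<^sub>F j in sequentially. f j x \<noteq> 0"
    using assms(1)[unfolded jet_conv_def] tendsto_imp_eventually_ne[OF _ assms(3)] by blast
  moreover have "\<forall>\<^sub>F j in sequentially. twice_diff b (f j) x" using assms(1) by (simp add: jet_conv_def)
  ultimately show "\<forall>\<^sub>F j in sequentially. \<forall>\<^sub>F y in nhds x. grauert_ext (f j y * cnj (f j y)) = of_real (grauert_metric (f j y))"
    by eventually_elim (rule *)
qed

section \<open>Holomorphic sectional curvature\<close>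

abbreviation cdir :: "'n \<Rightarrow> (complex^'n) \<times> (complex^'n)" where
  "cdir k \<equiv> (axis k 1, axis k \<i>)"

lemma cr_at_holo_on:
  assumes "holo_on U f" "z \<in> U"
  shows "cr_at (cdir k) f z"
proof -
  have "axis k \<i> = \<i> *s axis k 1"
    by (simp add: vec_eq_iff axis_def)
  then show ?thesis
    unfolding cr_at_def using holo_on_frechet_smult[OF assms, of \<i>] holo_on_differentiable[OF assms] by simp
qed

lemma wirt_holo_on:
  assumes "holo_on U f" "z \<in> U"
  shows "wirt k f z = frechet_derivative f (at z) (axis k 1)"
  unfolding wirt_eq_wder using cr_at_wder(2)[OF cr_at_holo_on[OF assms]] by simp

lemma holo_on_cong:
  assumes "holo_on U f" "open U" "\<And>z. z \<in> U \<Longrightarrow> f z = g z"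
  shows "holo_on U g"
  unfolding holo_on_def
proof
  fix z assume z: "z \<in> U"
  have "(g has_derivative frechet_derivative f (at z)) (at z)"
    by (rule has_derivative_transform_within_open[OF holo_on_has_derivative[OF assms(1) z] assms(2) z assms(3)])
  then show "\<exists>L. (g has_derivative L) (at z) \<and> (\<forall>c v. L (c *s v) = c * L v)"
    using holo_on_frechet_smult[OF assms(1) z] by blast
qed

lemma holo_on_wirt:
  assumes "holo_on U f" "open U"
  shows "holo_on U (wirt k f)"
  by (rule holo_on_cong[OF holo_on_frechet_derivative[OF assms] assms(2)]) (simp add: wirt_holo_on[OF assms(1)])

lemma jet_conv_holo_on:
  assumes U: "open U" "z \<in> U" and u: "\<And>j. holo_on U (u j)" "holo_on U u0"
    and lim: "(\<lambda>j. u j z) \<longlonglongrightarrow> u0 z"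
      "\<And>v. (\<lambda>j. frechet_derivative (u j) (at z) v) \<longlonglongrightarrow> frechet_derivative u0 (at z) v"
  shows "jet_conv (cdir k) (cdir l) z u u0"
    "jet_conv (cdir k) (cdir l) z (\<lambda>j y. cnj (u j y)) (\<lambda>y. cnj (u0 y))"
proof -
  have ev: "\<forall>\<^sub>F y in nhds z. cr_at (cdir l) h y" if "holo_on U h" for h
    using eventually_nhds_in_open[OF U] by eventually_elim (rule cr_at_holo_on[OF that])
  show "jet_conv (cdir k) (cdir l) z u u0"
    by (rule jet_conv_holo) (use ev cr_at_holo_on[OF _ U(2)] u lim in auto)
  show "jet_conv (cdir k) (cdir l) z (\<lambda>j y. cnj (u j y)) (\<lambda>y. cnj (u0 y))"
    by (rule jet_conv_cnj)
       (use ev cr_at_holo_on[OF _ U(2)] u lim holo_on_frechet_derivative[OF _ U(1)] in auto)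
qed

section \<open>Locally uniform convergence and jets of the metric coefficients\<close>

text \<open>Formulated with balls, so that the Cauchy estimates apply directly and passing to
  derivatives only shrinks the radius. It can thus be iterated to reach second derivatives.\<close>

definition loc_unif :: "(complex^'n) set \<Rightarrow> (nat \<Rightarrow> complex^'n \<Rightarrow> complex) \<Rightarrow> (complex^'n \<Rightarrow> complex) \<Rightarrow> bool" where
  "loc_unif U f f0 \<longleftrightarrow> (\<forall>z\<in>U. \<exists>r>0. ball z r \<subseteq> U \<and> uniform_limit (ball z r) f f0 sequentially)"

lemma loc_unif_tendsto: "loc_unif U f f0 \<Longrightarrow> z \<in> U \<Longrightarrow> (\<lambda>j. f j z) \<longlonglongrightarrow> f0 z"
  unfolding loc_unif_def by (metis centre_in_ball tendsto_uniform_limitI)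

lemma loc_unif_cong:
  assumes "loc_unif U f f0" "\<And>j z. z \<in> U \<Longrightarrow> f j z = g j z" "\<And>z. z \<in> U \<Longrightarrow> f0 z = g0 z"
  shows "loc_unif U g g0"
  unfolding loc_unif_def
proof
  fix z assume "z \<in> U"
  then obtain r where r: "r > 0" "ball z r \<subseteq> U" "uniform_limit (ball z r) f f0 sequentially"
    using assms(1) unfolding loc_unif_def by blast
  have "uniform_limit (ball z r) g g0 sequentially"
    using r(3) by (rule uniform_limit_cong'[THEN iffD1, rotated -1]) (use r(2) assms(2,3) in auto)
  then show "\<exists>r>0. ball z r \<subseteq> U \<and> uniform_limit (ball z r) g g0 sequentially"
    using r by blast
qed

lemma loc_unif_frechet:
  assumes "loc_unif U f f0" "\<And>j. holo_on U (f j)" "holo_on U f0"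
  shows "loc_unif U (\<lambda>j z. frechet_derivative (f j) (at z) v) (\<lambda>z. frechet_derivative f0 (at z) v)"
  unfolding loc_unif_def
proof
  fix z assume "z \<in> U"
  then obtain r where r: "r > 0" "ball z r \<subseteq> U" "uniform_limit (ball z r) f f0 sequentially"
    using assms(1) unfolding loc_unif_def by blast
  have "uniform_limit (ball z (r/2)) (\<lambda>j z. frechet_derivative (f j) (at z) v) (\<lambda>z. frechet_derivative f0 (at z) v) sequentially"
    by (rule holo_on_uniform_limit_frechet[OF _ _ r(3)]) (use r in \<open>auto intro: holo_on_subset[OF assms(2)] holo_on_subset[OF assms(3)]\<close>)
  moreover have "ball z (r/2) \<subseteq> U" using r by (auto intro: order_trans[OF subset_ball])
  ultimately show "\<exists>r>0. ball z r \<subseteq> U \<and>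
      uniform_limit (ball z r) (\<lambda>j z. frechet_derivative (f j) (at z) v) (\<lambda>z. frechet_derivative f0 (at z) v) sequentially"
    using r(1) by (intro exI[of _ "r/2"]) auto
qed

lemma loc_unif_wirt:
  assumes "loc_unif U f f0" "\<And>j. holo_on U (f j)" "holo_on U f0"
  shows "loc_unif U (\<lambda>j. wirt k (f j)) (wirt k f0)"
  by (rule loc_unif_cong[OF loc_unif_frechet[OF assms, of "axis k 1"]]) (simp_all add: wirt_holo_on[OF assms(2)] wirt_holo_on[OF assms(3)])

lemma jet_conv_loc_unif:
  assumes "open U" "z \<in> U" "loc_unif U f f0" "\<And>j. holo_on U (f j)" "holo_on U f0"
  shows "jet_conv (cdir k) (cdir l) z f f0"
    "jet_conv (cdir k) (cdir l) z (\<lambda>j y. cnj (f j y)) (\<lambda>y. cnj (f0 y))"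
  by (rule jet_conv_holo_on[OF assms(1,2,4,5)];
      use loc_unif_tendsto[OF assms(3,2)] loc_unif_tendsto[OF loc_unif_frechet[OF assms(3-5)] assms(2)] in blast)+

lemma has_derivative_vec_nth:
  assumes "(F has_derivative L) (at x)"
  shows "((\<lambda>x. F x $ i) has_derivative (\<lambda>v. L v $ i)) (at x)"
  by (rule bounded_linear.has_derivative[OF bounded_linear_vec_nth assms])

text \<open>Taking an entry is bounded linear and commutes with differentiation. Openness of
  \<open>U\<close> makes the identity for first derivatives hold near \<open>x\<close>, so that it
  can be differentiated once more.\<close>

lemma smooth_entry:
  fixes \<Phi> :: "'a::real_normed_vector \<Rightarrow> complex^'n^'m"
  assumes "smooth_fun_on U \<Phi>" "x \<in> U"
  shows "(\<lambda>x. \<Phi> x $ i $ j) differentiable at x"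
    and "open U \<Longrightarrow> (\<lambda>x. frechet_derivative (\<lambda>x. \<Phi> x $ i $ j) (at x) v) differentiable at x"
proof -
  have "Ck_on (Suc (Suc 0)) U \<Phi>" using assms(1) unfolding smooth_fun_on_def by blast
  then have 1: "\<And>y. y \<in> U \<Longrightarrow> \<Phi> differentiable at y"
    and 2: "(\<lambda>y. frechet_derivative \<Phi> (at y) v) differentiable at x"
    using assms(2) by auto
  have *: "((\<lambda>x. \<Phi> x $ i $ j) has_derivative (\<lambda>v. frechet_derivative \<Phi> (at y) v $ i $ j)) (at y)" if "y \<in> U" for y
    by (intro has_derivative_vec_nth frechet_derivative_worksI 1 that)
  show "(\<lambda>x. \<Phi> x $ i $ j) differentiable at x"
    using *[OF assms(2)] unfolding differentiable_def by blast
  assume "open U"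
  have "\<forall>\<^sub>F y in nhds x. frechet_derivative \<Phi> (at y) v $ i $ j = frechet_derivative (\<lambda>x. \<Phi> x $ i $ j) (at y) v"
    using eventually_nhds_in_open[OF \<open>open U\<close> assms(2)]
    by eventually_elim (simp add: frechet_derivative_at[OF *, symmetric])
  moreover have "(\<lambda>y. frechet_derivative \<Phi> (at y) v $ i $ j) differentiable at x"
    using has_derivative_vec_nth[OF has_derivative_vec_nth[OF frechet_derivative_worksI[OF 2]]]
    unfolding differentiable_def by blast
  ultimately show "(\<lambda>x. frechet_derivative (\<lambda>x. \<Phi> x $ i $ j) (at x) v) differentiable at x"
    by (rule differentiable_cong_nhds)
qed

lemma twice_diffI:
  assumes "open S" "x \<in> S" "\<And>y. y \<in> S \<Longrightarrow> f differentiable at y"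
    and "\<And>v. (\<lambda>y. frechet_derivative f (at y) v) differentiable at x"
  shows "twice_diff b f x"
  unfolding twice_diff_def
proof
  show "\<forall>\<^sub>F y in nhds x. f differentiable at y"
    using eventually_nhds_in_open[OF assms(1,2)] by eventually_elim (rule assms(3))
  show "wdbar b f differentiable at x"
    unfolding wder_def[abs_def] divide_inverse by (intro differentiable_mult differentiable_add assms(4) differentiable_const)
qed

lemma divisor_metric_entry:
  "divisor_metric \<Phi> f z $ i $ j = of_real (grauert_metric (f z)) * wirt i f z * cnj (wirt j f z) + \<Phi> z $ i $ j"
  by (simp add: divisor_metric_def pullback_conformal_def)

text \<open>Factor by factor: the Grauert factor, a holomorphic derivative, a conjugated one, and
  the fixed smooth coefficient of \<Phi> as a constant sequence.\<close>

lemma jet_conv_divisor_metric: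
  assumes U: "open U" "z \<in> U" and f: "loc_unif U f f0" "\<And>j. holo_on U (f j)" "holo_on U f0" "f0 z \<noteq> 0"
    and \<Phi>: "smooth_fun_on U \<Phi>"
  shows "jet_conv (cdir k) (cdir l) z (\<lambda>n y. divisor_metric \<Phi> (f n) y $ i $ j) (\<lambda>y. divisor_metric \<Phi> f0 y $ i $ j)"
  unfolding divisor_metric_entry
  by (intro jet_conv_add jet_conv_mult jet_conv_grauert jet_conv_const_seq twice_diffI[OF U]
      jet_conv_loc_unif[OF U] loc_unif_wirt holo_on_wirt f U smooth_entry[OF \<Phi>])

section \<open>Positivity and the inverse matrix\<close>

lemma herm_form_add: "herm_form (G + H) v w = herm_form G v w + herm_form H v w"
  by (simp add: herm_form_def algebra_simps sum.distrib)

lemma herm_form_pullback: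
  "herm_form (pullback_conformal f g z) v v = of_real (g (f z) * (cmod (\<Sum>i\<in>UNIV. wirt i f z * v $ i))\<^sup>2)"
  by (simp add: herm_form_def pullback_conformal_def complex_norm_square sum_product sum_distrib_left mult_ac del: of_real_power)
    (rule sum.swap)

text \<open>The pullback contributes a nonnegative multiple of |df(v)|^2, possibly 0; strict
  positivity comes from \<Phi>.\<close>

lemma divisor_metric_pos:
  assumes "hermitian_metric U \<Phi>" "z \<in> U" "v \<noteq> 0"
  shows "0 < norm_sq (divisor_metric \<Phi> f z) v"
proof -
  have "0 \<le> grauert_metric (f z)" by (simp add: grauert_metric_def)
  moreover have "0 < norm_sq (\<Phi> z) v" using assms by (simp add: hermitian_metric_def)
  ultimately show ?thesis
    by (simp add: norm_sq_def divisor_metric_def herm_form_add herm_form_pullback add_nonneg_pos del: of_real_mult)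
qed

text \<open>A kernel vector would be a null vector of the form. The transpose appears because
  \<open>herm_form\<close> contracts its first vector with the row index.\<close>

lemma det_nonzero_of_pos:
  assumes "\<And>v. v \<noteq> 0 \<Longrightarrow> 0 < norm_sq G v"
  shows "det G \<noteq> 0"
proof -
  have "v = 0" if "transpose G *v v = 0" for v
  proof (rule ccontr)
    assume "v \<noteq> 0"
    have "herm_form G v v = (\<Sum>j\<in>UNIV. (transpose G *v v) $ j * cnj (v $ j))"
      unfolding herm_form_def by (subst sum.swap) (simp add: matrix_vector_mult_def transpose_def sum_distrib_right)
    then have "norm_sq G v = 0" using that by (simp add: norm_sq_def)
    then show False using assms[OF \<open>v \<noteq> 0\<close>] by simp
  qed
  then have "invertible (transpose G)"
    by (simp add: invertible_left_inverse matrix_left_invertible_ker)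
  then show ?thesis by (simp add: invertible_det_nz det_transpose)
qed

text \<open>Cramer's rule for the right-hand side \<open>axis p 1\<close>. It exhibits entries of
  the inverse as quotients of polynomials in the entries of \<open>A\<close>, which yields their
  convergence.\<close>

lemma matrix_inv_entry:
  fixes A :: "'a::field^'n^'n"
  assumes "det A \<noteq> 0"
  shows "matrix_inv A $ q $ p = det (\<chi> i j. if j = q then axis p 1 $ i else A $ i $ j) / det A"
proof -
  have "A ** matrix_inv A = mat 1"
    using assms unfolding invertible_det_nz[symmetric] invertible_def matrix_inv_def
    by (metis (mono_tags, lifting) someI_ex)
  then have "A *v (matrix_inv A *v axis p 1) = axis p 1"
    by (simp add: matrix_vector_mul_assoc)
  then have "matrix_inv A *v axis p 1 = (\<chi> k. det (\<chi> i j. if j = k then axis p 1 $ i else A $ i $ j) / det A)"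
    using cramer[OF assms] by blast
  moreover have "(matrix_inv A *v axis p 1) $ q = matrix_inv A $ q $ p"
    by (simp add: matrix_vector_mult_def axis_def if_distrib cong: if_cong)
  ultimately show ?thesis by simp
qed

lemma tendsto_det:
  fixes A :: "'b \<Rightarrow> complex^'n^'n"
  assumes "\<And>i j. ((\<lambda>x. A x $ i $ j) \<longlongrightarrow> A0 $ i $ j) F"
  shows "((\<lambda>x. det (A x)) \<longlongrightarrow> det A0) F"
  unfolding det_def by (intro tendsto_intros assms)

lemma tendsto_matrix_inv:
  fixes A :: "'b \<Rightarrow> complex^'n^'n"
  assumes A: "\<And>i j. ((\<lambda>x. A x $ i $ j) \<longlongrightarrow> A0 $ i $ j) F" and "det A0 \<noteq> 0"
  shows "((\<lambda>x. matrix_inv (A x) $ q $ p) \<longlongrightarrow> matrix_inv A0 $ q $ p) F"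
proof (rule Lim_transform_eventually)
  show "((\<lambda>x. det (\<chi> i j. if j = q then axis p 1 $ i else A x $ i $ j) / det (A x)) \<longlongrightarrow> matrix_inv A0 $ q $ p) F"
    unfolding matrix_inv_entry[OF assms(2)]
    by (intro tendsto_divide tendsto_det A assms(2)) (auto intro: A)
  show "\<forall>\<^sub>F x in F. det (\<chi> i j. if j = q then axis p 1 $ i else A x $ i $ j) / det (A x) = matrix_inv (A x) $ q $ p"
    using tendsto_imp_eventually_ne[OF tendsto_det[OF A] assms(2)]
    by eventually_elim (simp add: matrix_inv_entry)
qed

text \<open>Positivity of the limit metric at \<open>p\<close> makes the two denominators,
  \<open>det (G0 p)\<close> inside the inverse and the squared norm of \<open>V\<close>, nonzero in
  the limit.\<close>

lemma hol_sect_curvature_tendsto: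
  assumes G: "\<And>i j k l. jet_conv (cdir k) (cdir l) p (\<lambda>n x. G n x $ i $ j) (\<lambda>x. G0 x $ i $ j)"
    and pos: "\<And>v. v \<noteq> 0 \<Longrightarrow> 0 < norm_sq (G0 p) v" and V: "V \<noteq> 0"
  shows "(\<lambda>n. hol_sect_curvature (G n) p V) \<longlonglongrightarrow> hol_sect_curvature G0 p V"
proof -
  have v: "(\<lambda>n. G n p $ i $ j) \<longlonglongrightarrow> G0 p $ i $ j" for i j
    using G unfolding jet_conv_def by blast
  have w: "(\<lambda>n. wirt k (\<lambda>x. G n x $ i $ j) p) \<longlonglongrightarrow> wirt k (\<lambda>x. G0 x $ i $ j) p" for i j k
    using G unfolding jet_conv_def wirt_eq_wder by blast
  have wb: "(\<lambda>n. wirt_bar l (\<lambda>x. G n x $ i $ j) p) \<longlonglongrightarrow> wirt_bar l (\<lambda>x. G0 x $ i $ j) p" for i j l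
    using G unfolding jet_conv_def wirt_eq_wder by blast
  have ww: "(\<lambda>n. wirt k (wirt_bar l (\<lambda>x. G n x $ i $ j)) p) \<longlonglongrightarrow> wirt k (wirt_bar l (\<lambda>x. G0 x $ i $ j)) p" for i j k l
    using G unfolding jet_conv_def wirt_eq_wder by blast
  have "norm_sq (G0 p) V \<noteq> 0" using pos[OF V] by simp
  moreover have "(\<lambda>n. norm_sq (G n p) V) \<longlonglongrightarrow> norm_sq (G0 p) V"
    unfolding norm_sq_def herm_form_def by (intro tendsto_intros v)
  ultimately show ?thesis
    unfolding hol_sect_curvature_def curvature_tensor_def
    by (intro tendsto_intros w wb ww tendsto_matrix_inv v det_nonzero_of_pos pos) auto
qed

section \<open>Leaf curvature\<close>

text \<open>The derivation of functions defined by the vector field \<open>X\<close>; along an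
  integral curve it becomes d/dT.\<close>

definition lie_deriv :: "(complex^'n \<Rightarrow> complex^'n) \<Rightarrow> (complex^'n \<Rightarrow> complex) \<Rightarrow> complex^'n \<Rightarrow> complex" where
  "lie_deriv X h z = frechet_derivative h (at z) (X z)"

lemma frechet_derivative_expand:
  assumes "holo_on U h" "z \<in> U"
  shows "frechet_derivative h (at z) v = (\<Sum>i\<in>UNIV. v $ i * frechet_derivative h (at z) (axis i 1))"
proof -
  have "frechet_derivative h (at z) v = frechet_derivative h (at z) (\<Sum>i\<in>UNIV. v $ i *s axis i 1)"
    by (simp only: basis_expansion)
  also have "\<dots> = (\<Sum>i\<in>UNIV. v $ i * frechet_derivative h (at z) (axis i 1))"
    by (simp add: linear_sum[OF linear_frechet_derivative[OF holo_on_differentiable[OF assms]]] holo_on_frechet_smult[OF assms])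
  finally show ?thesis .
qed

text \<open>The direction \<open>X z\<close> varies with \<open>z\<close>, whereas holomorphy of
  derivatives is known for fixed directions; expanding in the coordinate basis reduces to
  those.\<close>

lemma holo_on_lie_deriv:
  assumes "holo_on N h" "open N" "vec_holo_on N X"
  shows "holo_on N (lie_deriv X h)"
proof (rule holo_on_cong)
  show "holo_on N (\<lambda>z. \<Sum>i\<in>UNIV. X z $ i * frechet_derivative h (at z) (axis i 1))"
    using assms by (intro holo_on_sum holo_on_mult holo_on_frechet_derivative) (auto simp: vec_holo_on_def)
qed (use assms in \<open>simp_all add: lie_deriv_def frechet_derivative_expand[OF assms(1)]\<close>)

lemma leaf_param_has_derivative:
  assumes "leaf_param N X q \<epsilon> Z" "T \<in> ball 0 \<epsilon>"
  shows "(Z has_derivative (\<lambda>t. t *s X (Z T))) (at T)"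
proof -
  have "((\<lambda>S. \<Sum>i\<in>UNIV. Z S $ i *s axis i 1) has_derivative (\<lambda>t. \<Sum>i\<in>UNIV. (X (Z T) $ i * t) *s axis i 1)) (at T)"
  proof (rule has_derivative_sum)
    fix i
    have "((\<lambda>S. Z S $ i) has_derivative (\<lambda>t. X (Z T) $ i * t)) (at T)"
      using assms unfolding leaf_param_def has_field_derivative_def by blast
    then show "((\<lambda>S. Z S $ i *s axis i 1) has_derivative (\<lambda>t. (X (Z T) $ i * t) *s axis i 1)) (at T)"
      by (rule bounded_linear.has_derivative[OF bounded_linear_smult_left])
  qed
  moreover have "(\<Sum>i\<in>UNIV. (X (Z T) $ i * t) *s axis i 1) = t *s X (Z T)" for t
    using basis_expansion[of "t *s X (Z T)"] by (simp add: mult.commute)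
  ultimately show ?thesis by (simp add: basis_expansion)
qed

lemma leaf_param_in: "leaf_param N X q \<epsilon> Z \<Longrightarrow> T \<in> ball 0 \<epsilon> \<Longrightarrow> Z T \<in> N"
  unfolding leaf_param_def by blast

lemma leaf_param_comp:
  assumes "leaf_param N X q \<epsilon> Z" "holo_on N h" "T \<in> ball 0 \<epsilon>"
  shows "((\<lambda>T. h (Z T)) has_field_derivative lie_deriv X h (Z T)) (at T)"
proof -
  note N = leaf_param_in[OF assms(1,3)]
  have "((\<lambda>T. h (Z T)) has_derivative (\<lambda>t. frechet_derivative h (at (Z T)) (t *s X (Z T)))) (at T)"
    using has_derivative_compose[OF leaf_param_has_derivative[OF assms(1,3)] holo_on_has_derivative[OF assms(2) N]] .
  then show ?thesis
    unfolding has_field_derivative_def holo_on_frechet_smult[OF assms(2) N] lie_deriv_def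
    by (simp add: mult_commute_abs)
qed

lemma leaf_param_higher_deriv:
  assumes Z: "leaf_param N X q \<epsilon> Z" and h: "holo_on N h" and N: "open N" "vec_holo_on N X"
  shows "T \<in> ball 0 \<epsilon> \<Longrightarrow> (deriv ^^ n) (\<lambda>T. h (Z T)) T = ((lie_deriv X ^^ n) h) (Z T)"
proof (induction n arbitrary: T)
  case (Suc n)
  have hol: "holo_on N ((lie_deriv X ^^ n) h)"
    by (induction n) (auto intro: h holo_on_lie_deriv N)
  have "((deriv ^^ n) (\<lambda>T. h (Z T)) has_field_derivative lie_deriv X ((lie_deriv X ^^ n) h) (Z T)) (at T)"
    by (rule has_field_derivative_transform_within_open[OF leaf_param_comp[OF Z hol Suc.prems] open_ball Suc.prems])
       (simp only: Suc.IH)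
  then show ?case by (simp add: DERIV_imp_deriv)
qed simp

text \<open>
  Uniqueness of leaves without the theory of differential equations: the Taylor coefficients of
  $z_i \circ Z$ at 0 are the values at \<open>q\<close> of the iterated derivatives of $z_i$ along \<open>X\<close>.
\<close>

lemma leaf_param_unique:
  assumes Z: "leaf_param N X q \<epsilon> Z" and W: "leaf_param N X q \<delta> W" and N: "open N" "vec_holo_on N X"
    and T: "T \<in> ball 0 (min \<epsilon> \<delta>)"
  shows "Z T = W T"
proof -
  have "Z T $ i = W T $ i" for i
  proof (rule holomorphic_fun_eq_on_ball[where f="\<lambda>T. Z T $ i" and g="\<lambda>T. W T $ i"])
    have "(\<lambda>T. Y T $ i) holomorphic_on ball 0 (min \<epsilon> \<delta>)" if "leaf_param N X q \<rho> Y" "min \<epsilon> \<delta> \<le> \<rho>" for Y \<rho>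
      unfolding holomorphic_on_open[OF open_ball]
    proof
      fix S :: complex assume "S \<in> ball 0 (min \<epsilon> \<delta>)"
      then have "S \<in> ball 0 \<rho>" using that(2) by auto
      then show "\<exists>f'. ((\<lambda>T. Y T $ i) has_field_derivative f') (at S)"
        using that(1) unfolding leaf_param_def by blast
    qed
    then show "(\<lambda>T. Z T $ i) holomorphic_on ball 0 (min \<epsilon> \<delta>)" "(\<lambda>T. W T $ i) holomorphic_on ball 0 (min \<epsilon> \<delta>)"
      using Z W by auto
    show "(deriv ^^ n) (\<lambda>T. Z T $ i) 0 = (deriv ^^ n) (\<lambda>T. W T $ i) 0" for n
      using leaf_param_higher_deriv[OF Z holo_on_coord N, of 0] leaf_param_higher_deriv[OF W holo_on_coord N, of 0]
        Z W by (simp add: leaf_param_def)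
  qed (rule T)
  then show ?thesis by (simp add: vec_eq_iff)
qed

section \<open>From jets along a leaf to the leaf curvature\<close>

lemma gauss_curvature_cong:
  assumes "\<forall>\<^sub>F S in nhds T. g S = h S"
  shows "gauss_curvature g T = gauss_curvature h T"
proof -
  have e: "\<forall>\<^sub>F S in nhds T. complex_of_real (g S) = complex_of_real (h S)"
    using assms by eventually_elim simp
  show ?thesis
    unfolding gauss_curvature_def Let_def dT_eq_wder
    using wder_cong[OF e] wder_cong[OF wder_cong_nhds[OF e]] eventually_nhds_x_imp_x[OF assms] by simp
qed

text \<open>Any two parametrizations agree on the smaller disc and the Gaussian curvature at 0 sees
  only the germ, so the \<open>THE\<close> in \<open>leaf_curvature\<close> is well defined once a
  parametrization exists.\<close>

lemma leaf_curvature_eq: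
  assumes Z: "leaf_param N X q \<epsilon> Z" and N: "open N" "vec_holo_on N X"
  shows "leaf_curvature N X \<phi> q = gauss_curvature (\<lambda>T. norm_sq (\<phi> (Z T)) (X (Z T))) 0"
  unfolding leaf_curvature_def
proof (rule the_equality)
  fix \<kappa> assume "\<exists>\<delta> W. leaf_param N X q \<delta> W \<and> \<kappa> = gauss_curvature (\<lambda>T. norm_sq (\<phi> (W T)) (X (W T))) 0"
  then obtain \<delta> W where W: "leaf_param N X q \<delta> W" "\<kappa> = gauss_curvature (\<lambda>T. norm_sq (\<phi> (W T)) (X (W T))) 0"
    by blast
  have "0 < min \<epsilon> \<delta>" using Z W(1) by (simp add: leaf_param_def)
  then have "\<forall>\<^sub>F T in nhds 0. T \<in> ball (0::complex) (min \<epsilon> \<delta>)"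
    by (intro eventually_nhds_in_open) auto
  then have "\<forall>\<^sub>F T in nhds 0. norm_sq (\<phi> (W T)) (X (W T)) = norm_sq (\<phi> (Z T)) (X (Z T))"
    by eventually_elim (simp only: leaf_param_unique[OF Z W(1) N])
  then show "\<kappa> = gauss_curvature (\<lambda>T. norm_sq (\<phi> (Z T)) (X (Z T))) 0"
    unfolding W(2) by (rule gauss_curvature_cong)
qed (use Z in blast)

lemma gauss_curvature_tendsto:
  assumes J: "jet_conv (1, \<i>) (1, \<i>) T (\<lambda>n S. of_real (h n S)) (\<lambda>S. of_real (h0 S))" and "h0 T \<noteq> 0"
  shows "(\<lambda>n. gauss_curvature (h n) T) \<longlonglongrightarrow> gauss_curvature h0 T"
proof -
  note J' = J[unfolded jet_conv_def]
  have "(\<lambda>n. h n T) \<longlonglongrightarrow> h0 T" using J' by (simp add: tendsto_of_real_iff)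
  then show ?thesis
    unfolding gauss_curvature_def Let_def dT_eq_wder
    by (intro tendsto_intros) (use J' assms(2) in auto)
qed

lemma cr_at_field_derivative:
  assumes "(f has_field_derivative d) (at T)"
  shows "cr_at (1, \<i>) f T" "frechet_derivative f (at T) 1 = d"
proof -
  have "(f has_derivative (*) d) (at T)" using assms by (simp add: has_field_derivative_def)
  then have "frechet_derivative f (at T) = (*) d" "f differentiable at T"
    by (auto simp: frechet_derivative_at[symmetric] differentiable_def)
  then show "cr_at (1, \<i>) f T" "frechet_derivative f (at T) 1 = d"
    by (simp_all add: cr_at_def)
qed

lemma cr_at_cong:
  assumes "\<forall>\<^sub>F y in nhds x. f y = g y" "cr_at a f x"
  shows "cr_at a g x"
  using assms differentiable_cong_nhds frechet_derivative_cong[OF assms(1)] unfolding cr_at_def by metis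

text \<open>Along \<open>Z\<close> a holomorphic function becomes a holomorphic function of
  \<open>T\<close> with derivative \<open>lie_deriv X h\<close>; convergence at \<open>q\<close> of
  the functions and their first derivatives therefore suffices.\<close>

lemma jet_conv_leaf:
  assumes Z: "leaf_param N X q \<epsilon> Z" and N: "open N" "vec_holo_on N X"
    and u: "\<And>n. holo_on N (u n)" "holo_on N u0"
    and lim: "(\<lambda>n. u n q) \<longlonglongrightarrow> u0 q"
      "\<And>v. (\<lambda>n. frechet_derivative (u n) (at q) v) \<longlonglongrightarrow> frechet_derivative u0 (at q) v"
  shows "jet_conv (1, \<i>) (1, \<i>) 0 (\<lambda>n T. u n (Z T)) (\<lambda>T. u0 (Z T))"
    "jet_conv (1, \<i>) (1, \<i>) 0 (\<lambda>n T. cnj (u n (Z T))) (\<lambda>T. cnj (u0 (Z T)))"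
proof -
  have 0: "(0::complex) \<in> ball 0 \<epsilon>" and [simp]: "Z 0 = q" using Z by (simp_all add: leaf_param_def)
  have evb: "\<forall>\<^sub>F T in nhds 0. T \<in> ball (0::complex) \<epsilon>"
    using 0 by (intro eventually_nhds_in_open) auto
  have cr: "cr_at (1, \<i>) (\<lambda>T. h (Z T)) T" if "holo_on N h" "T \<in> ball 0 \<epsilon>" for h T
    by (rule cr_at_field_derivative(1)[OF leaf_param_comp[OF Z that]])
  have fd: "frechet_derivative (\<lambda>T. h (Z T)) (at T) 1 = lie_deriv X h (Z T)" if "holo_on N h" "T \<in> ball 0 \<epsilon>" for h T
    by (rule cr_at_field_derivative(2)[OF leaf_param_comp[OF Z that]])
  have ev: "\<forall>\<^sub>F T in nhds 0. cr_at (1, \<i>) (\<lambda>T. h (Z T)) T" if "holo_on N h" for h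
    using evb by eventually_elim (rule cr[OF that])
  \<comment> \<open>The derivative in \<open>T\<close> is itself a holomorphic function restricted
    to the leaf, as the rule for conjugates requires.\<close>
  have crd: "cr_at (1, \<i>) (\<lambda>T. frechet_derivative (\<lambda>T. h (Z T)) (at T) 1) 0" if "holo_on N h" for h
  proof (rule cr_at_cong)
    show "cr_at (1, \<i>) (\<lambda>T. lie_deriv X h (Z T)) 0"
      by (rule cr[OF holo_on_lie_deriv[OF that N] 0])
    show "\<forall>\<^sub>F T in nhds 0. lie_deriv X h (Z T) = frechet_derivative (\<lambda>T. h (Z T)) (at T) 1"
      using evb by eventually_elim (simp only: fd[OF that])
  qed
  have lim2: "(\<lambda>n. frechet_derivative (\<lambda>T. u n (Z T)) (at 0) 1) \<longlonglongrightarrow> frechet_derivative (\<lambda>T. u0 (Z T)) (at 0) 1"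
    unfolding fd[OF u(1) 0] fd[OF u(2) 0] lie_deriv_def using lim(2) by simp
  show "jet_conv (1, \<i>) (1, \<i>) 0 (\<lambda>n T. u n (Z T)) (\<lambda>T. u0 (Z T))"
    by (rule jet_conv_holo) (use ev[OF u(1)] ev[OF u(2)] cr[OF u(1) 0] cr[OF u(2) 0] lim(1) lim2 in simp_all)
  show "jet_conv (1, \<i>) (1, \<i>) 0 (\<lambda>n T. cnj (u n (Z T))) (\<lambda>T. cnj (u0 (Z T)))"
    by (rule jet_conv_cnj) (use ev[OF u(1)] ev[OF u(2)] cr[OF u(1) 0] cr[OF u(2) 0] crd[OF u(1)] crd[OF u(2)] lim(1) lim2 in simp_all)
qed

lemma real_basis_expansion: "v = (\<Sum>k\<in>UNIV. Re (v $ k) *\<^sub>R axis k 1 + Im (v $ k) *\<^sub>R axis k \<i>)" for v :: "complex^'n"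
proof -
  have "Re (v $ k) *\<^sub>R axis k 1 + Im (v $ k) *\<^sub>R axis k \<i> = v $ k *s axis k 1" for k
    by (auto simp: vec_eq_iff axis_def complex_eq_iff)
  then show ?thesis by (simp add: basis_expansion)
qed

text \<open>For merely smooth \<open>\<phi>\<close> the chain rule is only real linear, and the
  direction \<open>v *s X (Z T)\<close> moves with \<open>T\<close>. Expansion in the real basis
  leaves derivatives in fixed directions, with differentiable coefficients given by real and
  imaginary parts.\<close>

lemma twice_diff_leaf:
  fixes \<phi> :: "complex^'n \<Rightarrow> complex"
  assumes Z: "leaf_param N X q \<epsilon> Z" and X: "vec_holo_on N X"
    and \<phi>: "\<And>z. z \<in> N \<Longrightarrow> \<phi> differentiable at z"
      "\<And>z v. z \<in> N \<Longrightarrow> (\<lambda>y. frechet_derivative \<phi> (at y) v) differentiable at z"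
  shows "twice_diff b (\<lambda>T. \<phi> (Z T)) 0"
proof (rule twice_diffI)
  show 0: "(0::complex) \<in> ball 0 \<epsilon>" using Z by (simp add: leaf_param_def)
  have diffZ: "(\<lambda>T. \<psi> (Z T)) differentiable at T"
    if "T \<in> ball 0 \<epsilon>" "\<And>z. z \<in> N \<Longrightarrow> \<psi> differentiable at z" for T and \<psi> :: "complex^'n \<Rightarrow> complex"
    using has_derivative_compose[OF leaf_param_has_derivative[OF Z that(1)]
        frechet_derivative_worksI[OF that(2)[OF leaf_param_in[OF Z that(1)]]]]
    unfolding differentiable_def by blast
  show "(\<lambda>T. \<phi> (Z T)) differentiable at T" if "T \<in> ball 0 \<epsilon>" for T
    using that \<phi>(1) by (rule diffZ)
  fix v :: complex
  let ?D = "\<lambda>T a. frechet_derivative \<phi> (at (Z T)) a"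
  have fd: "frechet_derivative (\<lambda>T. \<phi> (Z T)) (at T) v =
      (\<Sum>k\<in>UNIV. of_real (Re (v * X (Z T) $ k)) * ?D T (axis k 1) + of_real (Im (v * X (Z T) $ k)) * ?D T (axis k \<i>))"
    if T: "T \<in> ball 0 \<epsilon>" for T
  proof -
    note d = \<phi>(1)[OF leaf_param_in[OF Z T]]
    note lin = linear_frechet_derivative[OF d]
    have "frechet_derivative (\<lambda>T. \<phi> (Z T)) (at T) = (\<lambda>t. ?D T (t *s X (Z T)))"
      using has_derivative_compose[OF leaf_param_has_derivative[OF Z T] frechet_derivative_worksI[OF d]]
      by (simp add: frechet_derivative_at[symmetric])
    then have "frechet_derivative (\<lambda>T. \<phi> (Z T)) (at T) v = ?D T (v *s X (Z T))" by simp
    also have "\<dots> = ?D T (\<Sum>k\<in>UNIV. Re ((v *s X (Z T)) $ k) *\<^sub>R axis k 1 + Im ((v *s X (Z T)) $ k) *\<^sub>R axis k \<i>)"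
      by (simp only: real_basis_expansion[symmetric])
    also have "\<dots> = (\<Sum>k\<in>UNIV. of_real (Re (v * X (Z T) $ k)) * ?D T (axis k 1) + of_real (Im (v * X (Z T) $ k)) * ?D T (axis k \<i>))"
      by (simp only: linear_sum[OF lin] linear_add[OF lin] linear_scale[OF lin] vector_smult_component)
        (simp only: scaleR_conv_of_real)
    finally show ?thesis .
  qed
  have dX: "(\<lambda>T. v * X (Z T) $ k) differentiable at 0" for k
    by (intro differentiable_mult differentiable_const diffZ[OF 0])
       (use X in \<open>auto simp: vec_holo_on_def intro: holo_on_differentiable\<close>)
  have bl: "bounded_linear (\<lambda>z. complex_of_real (Re z))" "bounded_linear (\<lambda>z. complex_of_real (Im z))"
    by (intro bounded_linear_compose[OF bounded_linear_of_real] bounded_linear_Re bounded_linear_Im)+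
  have dR: "(\<lambda>T. complex_of_real (Re (v * X (Z T) $ k))) differentiable at 0"
    "(\<lambda>T. complex_of_real (Im (v * X (Z T) $ k))) differentiable at 0" for k
    using bl[THEN bounded_linear.has_derivative, OF frechet_derivative_worksI[OF dX]]
    unfolding differentiable_def by blast+
  have "(\<lambda>T. \<Sum>k\<in>UNIV. of_real (Re (v * X (Z T) $ k)) * ?D T (axis k 1) + of_real (Im (v * X (Z T) $ k)) * ?D T (axis k \<i>)) differentiable at 0"
    by (intro differentiable_sum ballI differentiable_add differentiable_mult dR diffZ[OF 0] \<phi>(2)) auto
  then show "(\<lambda>T. frechet_derivative (\<lambda>T. \<phi> (Z T)) (at T) v) differentiable at 0"
  proof (rule differentiable_cong_nhds[rotated])
    show "\<forall>\<^sub>F T in nhds 0. (\<Sum>k\<in>UNIV. of_real (Re (v * X (Z T) $ k)) * ?D T (axis k 1) + of_real (Im (v * X (Z T) $ k)) * ?D T (axis k \<i>))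
        = frechet_derivative (\<lambda>T. \<phi> (Z T)) (at T) v"
      using eventually_nhds_in_open[OF open_ball 0] by eventually_elim (simp only: fd)
  qed
qed simp

text \<open>Hermitian symmetry makes \<open>herm_form G v v\<close> real. The jet calculus works on
  this complex polynomial expression, while curvatures are stated for
  \<open>norm_sq\<close>.\<close>

lemma of_real_norm_sq:
  assumes "\<And>i j. G $ j $ i = cnj (G $ i $ j)"
  shows "of_real (norm_sq G v) = herm_form G v v"
proof -
  have "cnj (herm_form G v v) = (\<Sum>i\<in>UNIV. \<Sum>j\<in>UNIV. G $ j $ i * v $ j * cnj (v $ i))"
    by (simp add: herm_form_def assms[symmetric] mult_ac)
  also have "\<dots> = herm_form G v v"
    unfolding herm_form_def by (rule sum.swap)
  finally show ?thesis
    by (simp add: norm_sq_def complex_eq_iff)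
qed

lemma divisor_metric_hermitian:
  assumes "hermitian_metric U \<Phi>" "z \<in> U"
  shows "divisor_metric \<Phi> f z $ j $ i = cnj (divisor_metric \<Phi> f z $ i $ j)"
proof -
  have "\<Phi> z $ j $ i = cnj (\<Phi> z $ i $ j)" using assms unfolding hermitian_metric_def by blast
  then show ?thesis by (simp add: divisor_metric_entry mult_ac)
qed

lemma leaf_curvature_tendsto:
  assumes U: "open U" and f: "loc_unif U f f0" "\<And>j. holo_on U (f j)" "holo_on U f0"
    and \<Phi>: "hermitian_metric U \<Phi>"
    and N: "open N" "N \<subseteq> U" "vec_holo_on N X" "\<And>z. z \<in> N \<Longrightarrow> X z \<noteq> 0"
    and q: "q \<in> N" "f0 q \<noteq> 0"
  shows "(\<lambda>n. leaf_curvature N X (divisor_metric \<Phi> (f n)) q) \<longlonglongrightarrow> leaf_curvature N X (divisor_metric \<Phi> f0) q"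
proof (cases "\<exists>\<epsilon> Z. leaf_param N X q \<epsilon> Z")
  case False
  \<comment> \<open>Existence of leaves need not be shown: without one, \<open>THE\<close> yields the same junk value for all metrics.\<close>
  then have "leaf_curvature N X \<phi> q = (THE \<kappa>. False)" for \<phi>
    unfolding leaf_curvature_def by metis
  then show ?thesis by simp
next
  case True
  then obtain \<epsilon> Z where Z: "leaf_param N X q \<epsilon> Z" by blast
  have 0: "(0::complex) \<in> ball 0 \<epsilon>" and Z0 [simp]: "Z 0 = q" using Z by (simp_all add: leaf_param_def)
  have qU: "q \<in> U" using q N by blast
  have smooth: "smooth_fun_on U \<Phi>" using \<Phi> by (simp add: hermitian_metric_def)
  have leaf: "jet_conv (1, \<i>) (1, \<i>) 0 (\<lambda>n T. u n (Z T)) (\<lambda>T. u0 (Z T))"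
    "jet_conv (1, \<i>) (1, \<i>) 0 (\<lambda>n T. cnj (u n (Z T))) (\<lambda>T. cnj (u0 (Z T)))"
    if "loc_unif U u u0" "\<And>j. holo_on U (u j)" "holo_on U u0" for u u0
    using jet_conv_leaf[OF Z N(1,3) holo_on_subset[OF that(2) N(2)] holo_on_subset[OF that(3) N(2)]
        loc_unif_tendsto[OF that(1) qU] loc_unif_tendsto[OF loc_unif_frechet[OF that] qU]] by blast+
  have Xleaf: "jet_conv (1, \<i>) (1, \<i>) 0 (\<lambda>n T. X (Z T) $ i) (\<lambda>T. X (Z T) $ i)"
    "jet_conv (1, \<i>) (1, \<i>) 0 (\<lambda>n T. cnj (X (Z T) $ i)) (\<lambda>T. cnj (X (Z T) $ i))" for i
    using jet_conv_leaf[OF Z N(1,3), of "\<lambda>_ z. X z $ i" "\<lambda>z. X z $ i"] N(3) by (simp_all add: vec_holo_on_def)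
  have \<Phi>leaf: "twice_diff (1, \<i>) (\<lambda>T. \<Phi> (Z T) $ i $ k) 0" for i k
    using N(2) by (intro twice_diff_leaf[OF Z N(3)] smooth_entry[OF smooth] U) auto
  \<comment> \<open>Expanding the form gives a finite sum of products of the factors already
    treated, with two further factors from \<open>X\<close> and its conjugate.\<close>
  have J: "jet_conv (1, \<i>) (1, \<i>) 0
      (\<lambda>n T. herm_form (divisor_metric \<Phi> (f n) (Z T)) (X (Z T)) (X (Z T)))
      (\<lambda>T. herm_form (divisor_metric \<Phi> f0 (Z T)) (X (Z T)) (X (Z T)))"
    unfolding herm_form_def divisor_metric_entry
    by (intro jet_conv_sum jet_conv_mult jet_conv_add jet_conv_grauert leaf Xleaf
        jet_conv_const_seq \<Phi>leaf loc_unif_wirt holo_on_wirt f U) (simp add: q)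
  have herm: "\<forall>\<^sub>F T in nhds 0. herm_form (divisor_metric \<Phi> g (Z T)) (X (Z T)) (X (Z T))
      = of_real (norm_sq (divisor_metric \<Phi> g (Z T)) (X (Z T)))" for g
    using eventually_nhds_in_open[OF open_ball 0]
  proof eventually_elim
    case (elim T)
    then have "Z T \<in> U" using leaf_param_in[OF Z] N(2) by blast
    then show ?case using of_real_norm_sq[OF divisor_metric_hermitian[OF \<Phi>]] by metis
  qed
  show ?thesis
    unfolding leaf_curvature_eq[OF Z N(1,3)]
  proof (rule gauss_curvature_tendsto)
    show "jet_conv (1, \<i>) (1, \<i>) 0 (\<lambda>n T. complex_of_real (norm_sq (divisor_metric \<Phi> (f n) (Z T)) (X (Z T))))
       (\<lambda>T. complex_of_real (norm_sq (divisor_metric \<Phi> f0 (Z T)) (X (Z T))))"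
      by (rule jet_conv_cong[OF _ herm J]) (simp add: herm)
    show "norm_sq (divisor_metric \<Phi> f0 (Z 0)) (X (Z 0)) \<noteq> 0"
      using divisor_metric_pos[OF \<Phi> qU N(4)[OF q(1)], of f0] by simp
  qed
qed

section \<open>Zero-free neighbourhoods and the final assembly\<close>

text \<open>On compact \<open>K\<close> the modulus of \<open>f0\<close> has a positive minimum;
  once the uniform error falls below it, \<open>f j\<close> cannot vanish on
  \<open>K\<close>.\<close>

lemma eventually_zero_free:
  assumes "uniform_limit K f f0 sequentially" "compact K" "continuous_on K f0" "\<And>z. z \<in> K \<Longrightarrow> f0 z \<noteq> (0::complex)"
  shows "\<forall>\<^sub>F j in sequentially. \<forall>z\<in>K. f j z \<noteq> 0"
proof (cases "K = {}")
  case False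
  have "continuous_on K (\<lambda>z. cmod (f0 z))" using assms(3) by (intro continuous_intros)
  from continuous_attains_inf[OF assms(2) False this]
  obtain z0 where z0: "z0 \<in> K" "\<And>z. z \<in> K \<Longrightarrow> cmod (f0 z0) \<le> cmod (f0 z)" by blast
  have "0 < cmod (f0 z0)" using assms(4) z0(1) by simp
  from uniform_limitD[OF assms(1) this] show ?thesis
  proof eventually_elim
    case (elim j)
    then show ?case using z0(2) by (fastforce simp: dist_norm)
  qed
qed simp

theorem theorem1p3:
  fixes U :: "(complex^'n) set"
    and \<Phi> :: "'n metric"
    and D :: "nat \<Rightarrow> 'n divisor" and D0 :: "'n divisor"
    and f :: "nat \<Rightarrow> complex^'n \<Rightarrow> complex" and f0 :: "complex^'n \<Rightarrow> complex"
    and p :: "complex^'n"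
  assumes U: "domain_Cn U"
    and \<Phi>: "complete_kahler_metric U \<Phi>"
    and H1: "H1_int_zero U"
    and f: "\<And>j. holo_on U (f j)" "\<And>j. \<exists>z\<in>U. f j z \<noteq> 0" "\<And>j. Div U (f j) = D j"
    and f0: "holo_on U f0" "\<exists>z\<in>U. f0 z \<noteq> 0" "Div U f0 = D0"
    and D_lim: "divisors_converge U D D0"
    and f_lim: "\<And>K. compact K \<Longrightarrow> K \<subseteq> U \<Longrightarrow> uniform_limit K f f0 sequentially"
    and p: "p \<in> U - zero_set U f0"
  shows "(\<forall>N X. open N \<and> p \<in> N \<and> N \<subseteq> U \<and> vec_holo_on N X \<and> (\<forall>z\<in>N. X z \<noteq> 0) \<longrightarrow>
            (\<exists>Up. open Up \<and> p \<in> Up \<and> Up \<subseteq> N \<and> Up \<subseteq> U - zero_set U f0 \<and>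
               (\<forall>\<^sub>F j in sequentially. Up \<subseteq> U - zero_set U (f j)) \<and>
               (\<forall>q\<in>Up. (\<lambda>j. leaf_curvature N X (divisor_metric \<Phi> (f j)) q)
                          \<longlonglongrightarrow> leaf_curvature N X (divisor_metric \<Phi> f0) q)))
       \<and> (\<forall>V. V \<noteq> 0 \<longrightarrow>
            ereal (hol_sect_curvature (divisor_metric \<Phi> f0) p V)
              \<le> liminf (\<lambda>j. ereal (hol_sect_curvature (divisor_metric \<Phi> (f j)) p V)))"
proof (intro conjI allI impI)
  have oU: "open U" using U by (simp add: domain_Cn_def)
  have herm: "hermitian_metric U \<Phi>" using \<Phi> by (simp add: complete_kahler_metric_def kahler_metric_def)
  then have smooth: "smooth_fun_on U \<Phi>" by (simp add: hermitian_metric_def)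
  have lu: "loc_unif U f f0"
    unfolding loc_unif_def
  proof
    fix z assume "z \<in> U"
    then obtain r where r: "r > 0" "cball z r \<subseteq> U" using oU open_contains_cball by blast
    have "uniform_limit (ball z r) f f0 sequentially"
      by (rule uniform_limit_on_subset[OF f_lim[OF compact_cball r(2)] ball_subset_cball])
    then show "\<exists>r>0. ball z r \<subseteq> U \<and> uniform_limit (ball z r) f f0 sequentially"
      using r ball_subset_cball by blast
  qed
  have pU: "p \<in> U" "f0 p \<noteq> 0" using p by (auto simp: zero_set_def)
  {
    fix V :: "complex^'n" assume V: "V \<noteq> 0"
    have "(\<lambda>j. hol_sect_curvature (divisor_metric \<Phi> (f j)) p V) \<longlonglongrightarrow> hol_sect_curvature (divisor_metric \<Phi> f0) p V"
      by (rule hol_sect_curvature_tendsto)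
         (rule jet_conv_divisor_metric[OF oU pU(1) lu f(1) f0(1) pU(2) smooth] divisor_metric_pos[OF herm pU(1)] V; assumption?)+
    then have "liminf (\<lambda>j. ereal (hol_sect_curvature (divisor_metric \<Phi> (f j)) p V)) = ereal (hol_sect_curvature (divisor_metric \<Phi> f0) p V)"
      by (intro lim_imp_Liminf) auto
    then show "ereal (hol_sect_curvature (divisor_metric \<Phi> f0) p V)
        \<le> liminf (\<lambda>j. ereal (hol_sect_curvature (divisor_metric \<Phi> (f j)) p V))"
      by simp
  }
  fix N and X :: "complex^'n \<Rightarrow> complex^'n"
  assume NX: "open N \<and> p \<in> N \<and> N \<subseteq> U \<and> vec_holo_on N X \<and> (\<forall>z\<in>N. X z \<noteq> 0)"
  have c: "continuous_on U f0" by (rule holo_on_imp_continuous_on[OF f0(1)])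
  then have "open (U \<inter> f0 -` (- {0}))" by (rule continuous_open_preimage[OF _ oU]) auto
  then have "open (N \<inter> (U \<inter> f0 -` (- {0})))" using NX by blast
  moreover have "p \<in> N \<inter> (U \<inter> f0 -` (- {0}))" using NX pU by blast
  ultimately obtain r where r: "r > 0" "cball p r \<subseteq> N \<inter> (U \<inter> f0 -` (- {0}))"
    using open_contains_cball by blast
  \<comment> \<open>The closed ball is compact, which gives one neighbourhood free of zeros of all
    \<open>f j\<close> with \<open>j\<close> large; its open ball serves as
    \<open>Up\<close>.\<close>
  have nz: "\<forall>\<^sub>F j in sequentially. \<forall>z\<in>cball p r. f j z \<noteq> 0"
    by (rule eventually_zero_free[OF f_lim[OF compact_cball] compact_cball continuous_on_subset[OF c]])
       (use r in auto)
  show "\<exists>Up. open Up \<and> p \<in> Up \<and> Up \<subseteq> N \<and> Up \<subseteq> U - zero_set U f0 \<and>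
               (\<forall>\<^sub>F j in sequentially. Up \<subseteq> U - zero_set U (f j)) \<and>
               (\<forall>q\<in>Up. (\<lambda>j. leaf_curvature N X (divisor_metric \<Phi> (f j)) q)
                          \<longlonglongrightarrow> leaf_curvature N X (divisor_metric \<Phi> f0) q)"
  proof (intro exI[of _ "ball p r"] conjI ballI)
    have sub: "ball p r \<subseteq> N \<inter> (U \<inter> f0 -` (- {0}))" using r ball_subset_cball by blast
    then show "ball p r \<subseteq> N" "ball p r \<subseteq> U - zero_set U f0" by (auto simp: zero_set_def)
    show "\<forall>\<^sub>F j in sequentially. ball p r \<subseteq> U - zero_set U (f j)"
      using nz
    proof eventually_elim
      case (elim j)
      then show ?case using sub ball_subset_cball[of p r] by (auto simp: zero_set_def)
    qed
    fix q assume "q \<in> ball p r"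
    then have "q \<in> N" "f0 q \<noteq> 0" using sub by blast+
    then show "(\<lambda>j. leaf_curvature N X (divisor_metric \<Phi> (f j)) q) \<longlonglongrightarrow> leaf_curvature N X (divisor_metric \<Phi> f0) q"
      using NX by (intro leaf_curvature_tendsto[OF oU lu f(1) f0(1) herm]) auto
  qed (use r in auto)
qed

end
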